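(* Let $G$ and $H$ be graphs, and let $F$ be a field of characteristic zero or larger than $2^{|V(G)||V(H)|}$. Then the rank of the Jacobian matrix $\mathcal{H}(G,H)$ of the minimal binomial generators of $J_{G,H}$ equals the analytic spread $\ell(J_{G,H})$.
   Context: Graphs are finite and simple with no isolated vertices. Let $V(G)=[n]$, $V(H)=[m]$. Binomial edge ideal of a pair: in $S=F[x_{i,j}\mid 1\le i\le n,1\le j\le m]$, for $e=\{i,j\}\in E(G)$ ($i<j$) and $e'=\{k,l\}\in E(H)$ ($k<l$) put $f_{e,e'}=x_{i,k}x_{j,l}-x_{i,l}x_{j,k}$, and let $J_{G,H}=(f_{e,e'}\mid e\in E(G),e'\in E(H))\subset S$. The $f_{e,e'}$ are the minimal binomial generators. $\mathcal{H}(G,H)$ is the $|E(G)||E(H)|\times nm$ Jacobian matrix with rows indexed by pairs $(e,e')\in E(G)\times E(H)$, columns indexed by the variables $x_{a,b}$, and entries $\partial f_{e,e'}/\partial x_{a,b}$; its rank is taken over $K=F(x_{i,j}\mid 1\le i\le n,1\le j\le m)$. Analytic spread: for an ideal $I\subset S$ with graded maximal ideal $\mathfrak m=(x_{i,j})$, $\ell(I)$ is the Krull dimension of the special fiber ring $\bigoplus_{k\ge0} I^k/\mathfrak m I^k$. *)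

theory Defs
  imports
    "HOL-Library.Poly_Mapping"
    "HOL-Library.Extended_Nat"
    "HOL-Library.Product_Lexorder"
    "HOL-Computational_Algebra.Polynomial"
    "HOL-Computational_Algebra.Fraction_Field"
    "HOL-Algebra.Algebraic_Closure_Type"
    "HOL-Algebra.Ideal_Product"
    "HOL-Analysis.Cartesian_Space"
begin

text \<open>
  The vertex sets $[n]$ and $[m]$ are finite linearly ordered types \<open>'n\<close> and \<open>'m\<close>; a graph is
  given by its set of edges, and an edge is a two-element set of vertices.
\<close>

definition simple_graph :: "'v set set \<Rightarrow> bool" where
  "simple_graph E \<longleftrightarrow> (\<forall>e\<in>E. card e = 2)"

definition no_isolated_vertices :: "'v set set \<Rightarrow> bool" where
  "no_isolated_vertices E \<longleftrightarrow> (\<forall>v. \<exists>e\<in>E. v \<in> e)"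

text \<open>
  The polynomial ring over \<open>'f\<close> in variables indexed by \<open>'v\<close>: finitely supported functions from
  exponent vectors to coefficients. The lexicographic order on \<open>'n \<times> 'm\<close> imported above only
  serves the library's proof that this ring is an integral domain.
\<close>

type_synonym ('v, 'f) mpoly = "('v \<Rightarrow>\<^sub>0 nat) \<Rightarrow>\<^sub>0 'f"

definition var :: "'v \<Rightarrow> ('v, 'f::comm_ring_1) mpoly" where
  "var v = Poly_Mapping.single (Poly_Mapping.single v 1) 1"

text \<open>
  Truncated subtraction of exponents is harmless: where it truncates, the factor
  \<open>of_nat (lookup t v)\<close> vanishes.
\<close>

definition partial_deriv :: "'v \<Rightarrow> ('v, 'f::comm_ring_1) mpoly \<Rightarrow> ('v, 'f) mpoly" where
  "partial_deriv v p =
     (\<Sum>t\<in>Poly_Mapping.keys p. Poly_Mapping.single (t - Poly_Mapping.single v 1)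
        (of_nat (Poly_Mapping.lookup t v) * Poly_Mapping.lookup p t))"

definition binomial_gen ::
    "'n::linorder set \<Rightarrow> 'm::linorder set \<Rightarrow> ('n \<times> 'm, 'f::comm_ring_1) mpoly" where
  "binomial_gen e e' =
     (let i = Min e; j = Max e; k = Min e'; l = Max e'
      in var (i, k) * var (j, l) - var (i, l) * var (j, k))"

definition binomial_edge_ideal ::
    "'n::linorder set set \<Rightarrow> 'm::linorder set set \<Rightarrow> ('n \<times> 'm, 'f::comm_ring_1) mpoly set" where
  "binomial_edge_ideal G H =
     genideal ring_of_type_algebra {binomial_gen e e' | e e'. e \<in> G \<and> e' \<in> H}"

definition graded_maximal_ideal :: "('v, 'f::comm_ring_1) mpoly set" where
  "graded_maximal_ideal = genideal ring_of_type_algebra (range var)"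

definition jacobian_row ::
    "'n::{finite,linorder} set \<Rightarrow> 'm::{finite,linorder} set
       \<Rightarrow> (('n \<times> 'm, 'f::field) mpoly fract) ^ ('n \<times> 'm)" where
  "jacobian_row e e' = (\<chi> ab. Fract (partial_deriv ab (binomial_gen e e')) 1)"

text \<open>
  As for \<^const>\<open>rank\<close>, the rank is the dimension of the row space; \<^const>\<open>rank\<close> itself is not
  applicable because the row index set \<open>G \<times> H\<close> is not a type. The argument of type \<open>'f itself\<close>
  determines the ground field.
\<close>

definition jacobian_rank ::
    "'f::field itself \<Rightarrow> 'n::{finite,linorder} set set \<Rightarrow> 'm::{finite,linorder} set set \<Rightarrow> nat" where
  "jacobian_rank _ G H =
     vec.dim {jacobian_row e e' :: (('n \<times> 'm, 'f) mpoly fract) ^ ('n \<times> 'm) | e e'.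
                e \<in> G \<and> e' \<in> H}"

text \<open>The supremum is over strictly ascending chains $P_0 \subset \dots \subset P_d$ of prime ideals.\<close>

definition krull_dim :: "('a, 'b) ring_scheme \<Rightarrow> enat" where
  "krull_dim R =
     Sup {enat d | d. \<exists>P :: nat \<Rightarrow> 'a set. (\<forall>i\<le>d. primeideal (P i) R) \<and> (\<forall>i<d. P i \<subset> P (Suc i))}"

definition ideal_power :: "'a::comm_ring_1 set \<Rightarrow> nat \<Rightarrow> 'a set" where
  "ideal_power I k = I [^]\<^bsub>ideals_set ring_of_type_algebra\<^esub> k"

text \<open>
  The ring $\bigoplus_{k} I^k / M I^k$: the graded ring $\bigoplus_{k} I^k t^k$, realised inside
  the polynomials in \<open>t\<close>, modulo its graded ideal $\bigoplus_{k} M I^k t^k$, so that addition and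
  multiplication are those induced on the graded pieces by the ambient ring.
\<close>

definition rees_algebra :: "'a::comm_ring_1 set \<Rightarrow> 'a poly ring" where
  "rees_algebra I =
     ring_of_type_algebra\<lparr>carrier := {p. \<forall>k. Polynomial.coeff p k \<in> ideal_power I k}\<rparr>"

definition special_fiber_ring :: "'a::comm_ring_1 set \<Rightarrow> 'a set \<Rightarrow> 'a poly set ring" where
  "special_fiber_ring M I =
     rees_algebra I Quot
       {p. \<forall>k. Polynomial.coeff p k \<in> ideal_prod ring_of_type_algebra M (ideal_power I k)}"

definition analytic_spread :: "('v, 'f::comm_ring_1) mpoly set \<Rightarrow> enat" where
  "analytic_spread I = krull_dim (special_fiber_ring graded_maximal_ideal I)"

end

theory Submission
  imports Defs
begin

text \<open>
  Let $A = F[f_{e,e'}]$ be the subalgebra generated by the generators. They are forms of the same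
  degree 2, so the special fiber ring is isomorphic to $A$, and both sides of the claim turn out to
  be the transcendence degree of $A$, that is, the size \<open>r\<close> of a maximal algebraically independent
  set \<open>T\<close> of generators.

  Krull dimension. If every $r + 1$ elements of $A$ are algebraically dependent, then a chain of
  primes $P_0 \subset \dots \subset P_{r+1}$ is impossible: for $x_i \in P_i \setminus P_{i-1}$,
  the lexicographically least term of a relation between the $x_i$ yields a unit in $P_{r+1}$. A chain of
  length \<open>r\<close> consists of the kernels on $A$ of successive substitutions of the variables, each of
  which lowers the transcendence degree of the image of $A$ by at most one.

  Jacobian rank. Complete \<open>T\<close> by variables to a transcendence basis of the polynomial ring. A
  count of monomials (as in Perron's theorem) shows that every form of degree at most 2 satisfies
  over this basis a relation of degree at most $2^r$, which is separable by the
  assumption on the characteristic. Differentiating the relations of the variables shows that the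
  gradients of the basis span everything, so those of \<open>T\<close> are independent; differentiating
  those of the other generators over \<open>T\<close> shows that their gradients depend on those of \<open>T\<close>.
\<close>

section \<open>Subalgebras and their growth\<close>

text \<open>Transcendence degree is handled by counting: \<open>growth_le\<close> bounds it from
  above, an \<open>indep\<close> list bounds it from below, and \<open>indep_length_le\<close> sets
  the two against each other wherever sizes of independent sets are compared. The kernel of a
  homomorphism into a domain is prime, so for a chain of kernels only strictness is at stake. Two
  homomorphisms with the same kernel on $A$ have isomorphic images; a drop in transcendence degree
  therefore forces a strict inclusion. On the Jacobian side the obstacle is the characteristic: the
  gradient of a p-th power vanishes in characteristic p, so a relation of \<open>h\<close> says
  something about \<open>grad h\<close> only if its derivative does not vanish at \<open>h\<close>.
  The bound $2^{nm}$ originates here: a transcendence basis has $nm$ members, of degree 1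
  (variables) or 2 (generators), and some relation of \<open>h\<close> over it has degree in
  \<open>h\<close> at most the product of these degrees.\<close>

locale field_algebra =
  fixes \<iota> :: "'f::field \<Rightarrow> 'a::idom"
  assumes \<iota>_add: "\<iota> (c + d) = \<iota> c + \<iota> d"
    and \<iota>_mult: "\<iota> (c * d) = \<iota> c * \<iota> d"
    and \<iota>_one [simp]: "\<iota> 1 = 1"
begin

lemma \<iota>_zero [simp]: "\<iota> 0 = 0"
  using \<iota>_add[of 0 0] by (metis add_0 add_cancel_right_left)

lemma \<iota>_minus: "\<iota> (- c) = - \<iota> c"
  using \<iota>_add[of c "- c"] by (simp add: eq_neg_iff_add_eq_0 add.commute)

lemma \<iota>_eq_0_iff [simp]: "\<iota> c = 0 \<longleftrightarrow> c = 0"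
proof
  assume "\<iota> c = 0"
  show "c = 0"
  proof (rule ccontr)
    assume "c \<noteq> 0"
    then have "\<iota> c * \<iota> (inverse c) = 1" by (simp flip: \<iota>_mult)
    with \<open>\<iota> c = 0\<close> show False by simp
  qed
qed simp

lemma \<iota>_of_nat: "\<iota> (of_nat k) = of_nat k"
  by (induction k) (simp_all add: \<iota>_add)

sublocale V: vector_space "\<lambda>c v. \<iota> c * v"
  by unfold_locales (simp_all add: \<iota>_add \<iota>_mult algebra_simps)

inductive_set alg :: "'a set \<Rightarrow> 'a set" for Z where
  const: "\<iota> c \<in> alg Z"
| gen: "z \<in> Z \<Longrightarrow> z \<in> alg Z"
| add: "a \<in> alg Z \<Longrightarrow> b \<in> alg Z \<Longrightarrow> a + b \<in> alg Z"
| mult: "a \<in> alg Z \<Longrightarrow> b \<in> alg Z \<Longrightarrow> a * b \<in> alg Z"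

lemma alg_0 [simp]: "0 \<in> alg Z" and alg_1 [simp]: "1 \<in> alg Z"
  using alg.const[of 0 Z] alg.const[of 1 Z] by auto

lemma alg_uminus: "a \<in> alg Z \<Longrightarrow> - a \<in> alg Z"
  using alg.mult[OF alg.const[of "- 1"], of a Z] by (simp add: \<iota>_minus)

lemma alg_sum: "(\<And>i. i \<in> I \<Longrightarrow> f i \<in> alg Z) \<Longrightarrow> sum f I \<in> alg Z"
  by (induction I rule: infinite_finite_induct) (auto intro: alg.add)

lemma alg_power: "a \<in> alg Z \<Longrightarrow> a ^ k \<in> alg Z"
  by (induction k) (auto intro: alg.mult)

lemma alg_prod_list: "(\<And>b. b \<in> set bs \<Longrightarrow> b \<in> alg Z) \<Longrightarrow> prod_list bs \<in> alg Z"
  by (induction bs) (auto intro: alg.mult)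

lemma alg_of_nat: "of_nat k \<in> alg Z"
  using alg.const[of "of_nat k" Z] by (simp add: \<iota>_of_nat)

lemma alg_subset_iff: "alg Z \<subseteq> alg Z' \<longleftrightarrow> Z \<subseteq> alg Z'"
proof
  assume Z: "Z \<subseteq> alg Z'"
  show "alg Z \<subseteq> alg Z'"
  proof
    fix a assume "a \<in> alg Z"
    then show "a \<in> alg Z'"
      by induction (use Z in \<open>auto intro: alg.intros\<close>)
  qed
qed (auto intro: alg.gen)

lemma alg_mono: "Z \<subseteq> Z' \<Longrightarrow> alg Z \<subseteq> alg Z'"
  by (auto simp: alg_subset_iff intro: alg.gen)

lemma span_subset_alg: "B \<subseteq> alg Z \<Longrightarrow> V.span B \<subseteq> alg Z"
proof
  fix x assume B: "B \<subseteq> alg Z" and "x \<in> V.span B"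
  from this(2) show "x \<in> alg Z"
    by (induction rule: V.span_induct_alt) (use B in \<open>auto intro: alg.intros\<close>)
qed

lemma poly_in_alg:
  assumes "\<And>i. Polynomial.coeff p i \<in> alg Z" "z \<in> alg Z"
  shows "poly p z \<in> alg Z"
  unfolding poly_altdef by (intro alg_sum alg.mult alg_power assms)

lemma coeff_mult_in_alg:
  assumes "\<And>i. Polynomial.coeff p i \<in> alg Z" "\<And>i. Polynomial.coeff q i \<in> alg Z"
  shows "Polynomial.coeff (p * q) i \<in> alg Z"
  unfolding coeff_mult by (intro alg_sum alg.mult assms)

text \<open>The gateway for adjoining generators one at a time: degree, roots and division of
  univariate polynomials become available for subalgebras.\<close>

lemma alg_insertE:
  assumes "a \<in> alg (insert z Z)"
  obtains p where "\<And>i. Polynomial.coeff p i \<in> alg Z" "poly p z = a"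
proof -
  from assms have "\<exists>p. (\<forall>i. Polynomial.coeff p i \<in> alg Z) \<and> poly p z = a"
  proof induction
    case (const c)
    show ?case by (rule exI[of _ "[:\<iota> c:]"]) (auto simp: coeff_pCons alg.const split: nat.split)
  next
    case (gen x)
    show ?case
    proof (cases "x = z")
      case True
      then show ?thesis
        by (intro exI[of _ "[:0, 1:]"]) (auto simp: coeff_pCons split: nat.split)
    next
      case False
      with gen show ?thesis
        by (intro exI[of _ "[:x:]"]) (auto simp: coeff_pCons intro: alg.gen split: nat.split)
    qed
  next
    case (add a b)
    then obtain p q where "\<forall>i. Polynomial.coeff p i \<in> alg Z" "poly p z = a"
      "\<forall>i. Polynomial.coeff q i \<in> alg Z" "poly q z = b" by blast
    then show ?case by (intro exI[of _ "p + q"]) (auto intro: alg.add)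
  next
    case (mult a b)
    then obtain p q where "\<forall>i. Polynomial.coeff p i \<in> alg Z" "poly p z = a"
      "\<forall>i. Polynomial.coeff q i \<in> alg Z" "poly q z = b" by blast
    then show ?case by (intro exI[of _ "p * q"]) (auto intro: coeff_mult_in_alg)
  qed
  then show thesis using that by blast
qed

text \<open>For a subring \<open>B\<close> this is algebraicity over its fraction field with
  denominators cleared. The leading coefficient is arbitrary; it reappears as the multiplier in
  \<open>growth_le\<close> and as a side condition in \<open>algebraic_over_image\<close>.\<close>

definition algebraic_over :: "'a set \<Rightarrow> 'a \<Rightarrow> bool" where
  "algebraic_over B z \<longleftrightarrow> (\<exists>p. p \<noteq> 0 \<and> (\<forall>i. Polynomial.coeff p i \<in> B) \<and> poly p z = 0)"

lemma algebraic_over_mono: "algebraic_over B z \<Longrightarrow> B \<subseteq> B' \<Longrightarrow> algebraic_over B' z"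
  unfolding algebraic_over_def by blast

lemma algebraic_over_alg_self: "z \<in> alg Z \<Longrightarrow> algebraic_over (alg Z) z"
  unfolding algebraic_over_def
  by (rule exI[of _ "[:- z, 1:]"]) (auto simp: coeff_pCons alg_uminus split: nat.split)

text \<open>Exactly \<open>D\<close> factors: lengths add when spans are multiplied, and products of
  forms of one degree stay homogeneous. Shorter products are included once 1 belongs to
  \<open>B\<close>.\<close>

definition products :: "'a set \<Rightarrow> nat \<Rightarrow> 'a set" where
  "products B D = {prod_list bs | bs. set bs \<subseteq> B \<and> length bs = D}"

lemma products_0 [simp]: "products B 0 = {1}"
  by (auto simp: products_def)

lemma products_Suc: "products B (Suc D) = {b * v | b v. b \<in> B \<and> v \<in> products B D}"
proof (intro equalityI subsetI)
  fix x assume "x \<in> products B (Suc D)"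
  then obtain bs where "x = prod_list bs" "set bs \<subseteq> B" "length bs = Suc D"
    by (auto simp: products_def)
  then show "x \<in> {b * v | b v. b \<in> B \<and> v \<in> products B D}"
    by (cases bs) (auto simp: products_def)
next
  fix x assume "x \<in> {b * v | b v. b \<in> B \<and> v \<in> products B D}"
  then obtain b bs where "x = prod_list (b # bs)" "b \<in> B" "set bs \<subseteq> B" "length bs = D"
    by (auto simp: products_def)
  then show "x \<in> products B (Suc D)"
    unfolding products_def by (metis (mono_tags, lifting) insert_subset length_Cons list.simps(15) mem_Collect_eq)
qed

lemma products_mult: "a \<in> products B D \<Longrightarrow> b \<in> products B E \<Longrightarrow> a * b \<in> products B (D + E)"
  unfolding products_def
  by (smt (verit, best) Un_subset_iff length_append mem_Collect_eq prod_list.append set_append)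

lemma span_mult_left:
  assumes "\<And>x. x \<in> A \<Longrightarrow> b * x \<in> V.span C" "v \<in> V.span A"
  shows "b * v \<in> V.span C"
  using assms(2)
proof (induction rule: V.span_induct_alt)
  case (step c x y)
  have "b * (\<iota> c * x + y) = \<iota> c * (b * x) + b * y" by (simp add: algebra_simps)
  then show ?case using assms(1)[OF step(1)] step(2) by (auto intro: V.span_add V.span_scale)
qed (auto intro: V.span_zero)

lemma span_products_mult:
  assumes "a \<in> V.span (products B D)" "b \<in> V.span (products B E)"
  shows "a * b \<in> V.span (products B (D + E))"
proof (rule span_mult_left[OF _ assms(2)])
  fix y assume y: "y \<in> products B E"
  have "y * a \<in> V.span (products B (D + E))"
    by (rule span_mult_left[OF _ assms(1)])
      (metis V.span_base add.commute products_mult y)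
  then show "a * y \<in> V.span (products B (D + E))" by (simp add: mult.commute)
qed

lemma base_in_span_products: "b \<in> B \<Longrightarrow> b \<in> V.span (products B 1)"
  by (rule V.span_base) (auto simp: products_Suc)

lemma power_in_products: "b \<in> B \<Longrightarrow> b ^ k \<in> products B k"
  by (induction k) (auto simp: products_Suc)

text \<open>
  A denominator-tolerant form of Gelfand--Kirillov dimension at most \<open>r\<close>: adjoining an algebraic
  element does not change it, and adjoining an arbitrary one raises it by at most one.
\<close>

definition growth_le :: "'a set \<Rightarrow> nat \<Rightarrow> bool" where
  "growth_le Z r \<longleftrightarrow> (\<forall>B. finite B \<longrightarrow> B \<subseteq> alg Z \<longrightarrow>
     (\<exists>C::nat. \<forall>D. \<exists>q U. q \<noteq> 0 \<and> finite U \<and> card U \<le> C * (D + 1) ^ r \<and>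
        (\<forall>v\<in>products B D. q * v \<in> V.span U)))"

lemma growth_leD:
  assumes "growth_le Z r" "finite B" "B \<subseteq> alg Z"
  obtains C :: nat where "\<And>D. \<exists>q U. q \<noteq> 0 \<and> finite U \<and> card U \<le> C * (D + 1) ^ r \<and>
        (\<forall>v\<in>products B D. q * v \<in> V.span U)"
proof -
  have "\<exists>C::nat. \<forall>D. \<exists>q U. q \<noteq> 0 \<and> finite U \<and> card U \<le> C * (D + 1) ^ r \<and>
        (\<forall>v\<in>products B D. q * v \<in> V.span U)"
    using assms(1)[unfolded growth_le_def, rule_format, OF assms(2,3)] .
  with that show thesis by (elim exE) blast
qed

lemma alg_empty: "alg {} = range \<iota>"
proof
  show "alg {} \<subseteq> range \<iota>"
  proof
    fix a assume "a \<in> alg {}"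
    then show "a \<in> range \<iota>"
      by induction (auto simp flip: \<iota>_add \<iota>_mult)
  qed
qed (auto intro: alg.const)

lemma growth_le_empty: "growth_le {} 0"
  unfolding growth_le_def
proof (intro allI impI exI)
  fix B D assume "finite B" "B \<subseteq> alg {}"
  show "(1::'a) \<noteq> 0 \<and> finite {1::'a} \<and> card {1::'a} \<le> 1 * (D + 1) ^ 0 \<and>
     (\<forall>v\<in>products B D. 1 * v \<in> V.span {1})"
  proof (intro conjI ballI)
    fix v assume "v \<in> products B D"
    then have "v \<in> alg {}" using \<open>B \<subseteq> alg {}\<close>
      by (auto simp: products_def intro: alg_prod_list)
    then show "1 * v \<in> V.span {1}" unfolding alg_empty V.span_singleton by auto
  qed auto
qed

lemma alg_insert_family:
  assumes "finite B" "B \<subseteq> alg (insert z Z)"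
  obtains P m B0 where "finite B0" "B0 \<subseteq> alg Z" "1 \<in> B0"
    "\<And>b. b \<in> B \<Longrightarrow> poly (P b) z = b" "\<And>b. b \<in> B \<Longrightarrow> Polynomial.degree (P b) \<le> m"
    "\<And>b i. b \<in> B \<Longrightarrow> Polynomial.coeff (P b) i \<in> insert 0 B0"
proof -
  have "\<forall>b\<in>B. \<exists>p. (\<forall>i. Polynomial.coeff p i \<in> alg Z) \<and> poly p z = b"
    using assms(2) by (meson alg_insertE subsetD)
  then obtain P where P: "\<And>b i. b \<in> B \<Longrightarrow> Polynomial.coeff (P b) i \<in> alg Z"
    "\<And>b. b \<in> B \<Longrightarrow> poly (P b) z = b" by metis
  define m where "m = Max (insert 0 ((\<lambda>b. Polynomial.degree (P b)) ` B))"
  define B0 where "B0 = insert 1 (\<Union>b\<in>B. Polynomial.coeff (P b) ` {..m})"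
  have deg: "Polynomial.degree (P b) \<le> m" if "b \<in> B" for b
    unfolding m_def using that assms(1) by auto
  show thesis
  proof (rule that[of B0 P m])
    show "finite B0" "B0 \<subseteq> alg Z" "1 \<in> B0" using assms(1) P by (auto simp: B0_def)
    fix b assume b: "b \<in> B"
    show "Polynomial.coeff (P b) i \<in> insert 0 B0" for i
    proof (cases "i \<le> m")
      case False
      then have "Polynomial.coeff (P b) i = 0" using deg[OF b] by (intro coeff_eq_0) auto
      then show ?thesis by simp
    qed (auto simp: B0_def b)
  qed (use deg P in auto)
qed

text \<open>Each factor of \<open>v\<close> contributes one factor from \<open>B0\<close> to every
  coefficient, so growth over \<open>Z\<close> applies to the coefficients with the same
  \<open>D\<close>.\<close>

lemma products_as_poly:
  assumes "\<And>b. b \<in> B \<Longrightarrow> poly (P b) z = b" "\<And>b. b \<in> B \<Longrightarrow> Polynomial.degree (P b) \<le> m"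
    "\<And>b i. b \<in> B \<Longrightarrow> Polynomial.coeff (P b) i \<in> insert 0 B0"
    "v \<in> products B D"
  shows "\<exists>p. poly p z = v \<and> Polynomial.degree p \<le> m * D \<and>
    (\<forall>i. Polynomial.coeff p i \<in> V.span (products B0 D))"
  using assms(4)
proof (induction D arbitrary: v)
  case 0
  then show ?case
    by (intro exI[of _ 1]) (auto simp: V.span_base V.span_zero coeff_1)
next
  case (Suc D)
  then obtain b w where bw: "v = b * w" "b \<in> B" "w \<in> products B D" by (auto simp: products_Suc)
  then obtain p where p: "poly p z = w" "Polynomial.degree p \<le> m * D"
    "\<forall>i. Polynomial.coeff p i \<in> V.span (products B0 D)" using Suc by blast
  have c: "Polynomial.coeff (P b) i \<in> V.span (products B0 1)" for i
    using assms(3)[OF bw(2), of i] base_in_span_products by (auto intro: V.span_zero)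
  show ?case
  proof (intro exI[of _ "P b * p"] conjI allI)
    show "Polynomial.degree (P b * p) \<le> m * Suc D"
      using degree_mult_le[of "P b" p] assms(2)[OF bw(2)] p(2) by simp
    show "Polynomial.coeff (P b * p) i \<in> V.span (products B0 (Suc D))" for i
      unfolding coeff_mult using span_products_mult[OF c] p(3)
      by (intro V.span_sum) (metis plus_1_eq_Suc)
  qed (use bw p assms(1) in auto)
qed

lemma poly_span:
  assumes "Polynomial.degree p < n" "\<And>i. i < n \<Longrightarrow> q * Polynomial.coeff p i \<in> V.span U"
  shows "q * poly p z \<in> V.span ((\<lambda>(u, i). u * z ^ i) ` (U \<times> {..<n}))"
proof -
  have "poly p z = (\<Sum>i<n. Polynomial.coeff p i * z ^ i)"
    unfolding poly_altdef by (rule sum.mono_neutral_left) (use assms(1) in \<open>auto simp: coeff_eq_0\<close>)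
  then have "q * poly p z = (\<Sum>i<n. z ^ i * (q * Polynomial.coeff p i))"
    by (simp add: sum_distrib_left algebra_simps)
  also have "\<dots> \<in> V.span ((\<lambda>(u, i). u * z ^ i) ` (U \<times> {..<n}))"
  proof (rule V.span_sum)
    fix i assume i: "i \<in> {..<n}"
    show "z ^ i * (q * Polynomial.coeff p i) \<in> V.span ((\<lambda>(u, i). u * z ^ i) ` (U \<times> {..<n}))"
    proof (rule span_mult_left[OF _ assms(2)])
      fix u assume "u \<in> U"
      then have "u * z ^ i \<in> (\<lambda>(u, i). u * z ^ i) ` (U \<times> {..<n})" using i by force
      then show "z ^ i * u \<in> V.span ((\<lambda>(u, i). u * z ^ i) ` (U \<times> {..<n}))"
        unfolding mult.commute[of "z ^ i" u] by (rule V.span_base)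
    qed (use i in auto)
  qed
  finally show ?thesis .
qed

lemma card_poly_span:
  assumes "finite U"
  shows "finite ((\<lambda>(u, i). u * z ^ i) ` (U \<times> {..<n}))"
    "card ((\<lambda>(u, i). u * z ^ i) ` (U \<times> {..<n})) \<le> card U * n"
  using assms card_image_le[of "U \<times> {..<n}"] by auto

text \<open>A \<open>D\<close>-fold product is a polynomial in \<open>z\<close> of degree at most
  \<open>m * D\<close>, so \<open>m * D + 1\<close> powers of \<open>z\<close> suffice; they are the
  extra factor of order \<open>D + 1\<close>.\<close>

lemma growth_le_insert:
  assumes "growth_le Z r"
  shows "growth_le (insert z Z) (Suc r)"
  unfolding growth_le_def
proof (intro allI impI)
  fix B assume "finite B" "B \<subseteq> alg (insert z Z)"
  then obtain P m B0 where B0: "finite B0" "B0 \<subseteq> alg Z" "1 \<in> B0"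
    "\<And>b. b \<in> B \<Longrightarrow> poly (P b) z = b" "\<And>b. b \<in> B \<Longrightarrow> Polynomial.degree (P b) \<le> m"
    "\<And>b i. b \<in> B \<Longrightarrow> Polynomial.coeff (P b) i \<in> insert 0 B0" by (rule alg_insert_family) blast
  obtain C :: nat where C: "\<And>D. \<exists>q U. q \<noteq> 0 \<and> finite U \<and> card U \<le> C * (D + 1) ^ r \<and>
        (\<forall>v\<in>products B0 D. q * v \<in> V.span U)" using growth_leD[OF assms B0(1,2)] by blast
  show "\<exists>C::nat. \<forall>D. \<exists>q U. q \<noteq> 0 \<and> finite U \<and> card U \<le> C * (D + 1) ^ Suc r \<and>
        (\<forall>v\<in>products B D. q * v \<in> V.span U)"
  proof (intro exI[of _ "C * (m + 1)"] allI)
    fix D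
    obtain q U where q: "q \<noteq> 0" "finite U" "card U \<le> C * (D + 1) ^ r"
        "\<forall>v\<in>products B0 D. q * v \<in> V.span U" using C by blast
    define W where "W = (\<lambda>(u, i). u * z ^ i) ` (U \<times> {..<m * D + 1})"
    have "card W \<le> card U * (m * D + 1)" unfolding W_def by (rule card_poly_span[OF q(2)])
    also have "\<dots> \<le> (C * (D + 1) ^ r) * ((m + 1) * (D + 1))"
      by (intro mult_mono q(3)) (auto simp: algebra_simps)
    finally have "card W \<le> C * (m + 1) * (D + 1) ^ Suc r" by (simp add: algebra_simps)
    moreover have "q * v \<in> V.span W" if "v \<in> products B D" for v
    proof -
      obtain p where p: "poly p z = v" "Polynomial.degree p \<le> m * D"
        "\<forall>i. Polynomial.coeff p i \<in> V.span (products B0 D)"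
        using products_as_poly[OF B0(4-6) \<open>v \<in> _\<close>] by blast
      show ?thesis unfolding W_def p(1)[symmetric]
        by (rule poly_span) (use p in \<open>auto simp: less_Suc_eq_le intro!: span_mult_left[OF bspec[OF q(4)]]\<close>)
    qed
    moreover have "finite W" unfolding W_def by (rule card_poly_span[OF q(2)])
    ultimately show "\<exists>q U. q \<noteq> 0 \<and> finite U \<and> card U \<le> C * (m + 1) * (D + 1) ^ Suc r \<and>
        (\<forall>v\<in>products B D. q * v \<in> V.span U)" using q(1) by blast
  qed
qed

text \<open>Division with remainder by a polynomial that need not be monic: lowering the degree by
  one costs a factor \<open>lead_coeff p\<close> and lengthens the products in the coefficients by
  one.\<close>

lemma pseudo_reduction:
  assumes p: "poly p z = 0" "\<And>i. Polynomial.coeff p i \<in> insert 0 B"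
    and e: "e = Polynomial.degree p"
    and P: "\<And>i. i \<ge> e + n \<Longrightarrow> Polynomial.coeff P i = 0"
      "\<And>i. Polynomial.coeff P i \<in> V.span (products B D)"
  shows "\<exists>R. lead_coeff p ^ n * poly P z = poly R z \<and> (\<forall>i\<ge>e. Polynomial.coeff R i = 0) \<and>
     (\<forall>i. Polynomial.coeff R i \<in> V.span (products B (D + n)))"
  using P
proof (induction n arbitrary: P D)
  case 0
  then show ?case by (intro exI[of _ P]) auto
next
  case (Suc n)
  define a where "a = Polynomial.coeff P (e + n)"
  define P' where "P' = Polynomial.smult (lead_coeff p) P - Polynomial.monom a n * p"
  have cp: "Polynomial.coeff p i \<in> V.span (products B 1)" for i
    using p(2)[of i] base_in_span_products by (auto intro: V.span_zero)
  have 1: "Polynomial.coeff P' i = 0" if "i \<ge> e + n" for i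
  proof (cases "i = e + n")
    case True
    then show ?thesis
      by (simp add: P'_def a_def e coeff_monom_mult)
  next
    case False
    then show ?thesis using that Suc.prems(1)[of i]
      by (simp add: P'_def coeff_monom_mult e coeff_eq_0)
  qed
  have 2: "Polynomial.coeff P' i \<in> V.span (products B (Suc D))" for i
  proof -
    have "lead_coeff p * Polynomial.coeff P i \<in> V.span (products B (1 + D))"
      by (intro span_products_mult cp Suc.prems)
    moreover have "a * (if n \<le> i then Polynomial.coeff p (i - n) else 0) \<in> V.span (products B (D + 1))"
      unfolding a_def by (intro span_products_mult Suc.prems) (use cp in \<open>auto intro: V.span_zero\<close>)
    ultimately have "lead_coeff p * Polynomial.coeff P i
      - a * (if n \<le> i then Polynomial.coeff p (i - n) else 0) \<in> V.span (products B (Suc D))"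
      by (intro V.span_diff) auto
    then show ?thesis by (simp add: P'_def coeff_monom_mult split: if_splits)
  qed
  obtain R where R: "lead_coeff p ^ n * poly P' z = poly R z" "\<forall>i\<ge>e. Polynomial.coeff R i = 0"
     "\<forall>i. Polynomial.coeff R i \<in> V.span (products B (Suc D + n))"
    using Suc.IH[of P' "Suc D", OF 1 2] by blast
  moreover have "poly P' z = lead_coeff p * poly P z" by (simp add: P'_def p(1))
  ultimately show ?case by (intro exI[of _ R]) (auto simp: algebra_simps)
qed

text \<open>Modulo the relation of \<open>z\<close> only the powers below its degree
  \<open>e\<close> are left, a constant number, so the exponent stays \<open>r\<close>. The price is
  the factor \<open>lead_coeff p ^ (m * D)\<close>, and for this reason growth is defined up to a
  multiplier \<open>q\<close>.\<close>

lemma growth_le_insert_algebraic: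
  assumes "growth_le Z r" "algebraic_over (alg Z) z"
  shows "growth_le (insert z Z) r"
  unfolding growth_le_def
proof (intro allI impI)
  fix B assume "finite B" "B \<subseteq> alg (insert z Z)"
  then obtain P m B0 where B0: "finite B0" "B0 \<subseteq> alg Z" "1 \<in> B0"
    "\<And>b. b \<in> B \<Longrightarrow> poly (P b) z = b" "\<And>b. b \<in> B \<Longrightarrow> Polynomial.degree (P b) \<le> m"
    "\<And>b i. b \<in> B \<Longrightarrow> Polynomial.coeff (P b) i \<in> insert 0 B0" by (rule alg_insert_family) blast
  obtain p where p: "p \<noteq> 0" "\<And>i. Polynomial.coeff p i \<in> alg Z" "poly p z = 0"
    using assms(2) by (auto simp: algebraic_over_def)
  define e where "e = Polynomial.degree p"
  have "e > 0"
  proof (rule ccontr)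
    assume "\<not> e > 0"
    then obtain c where "p = [:c:]" using degree_eq_zeroE unfolding e_def by auto
    with p show False by auto
  qed
  define B1 where "B1 = B0 \<union> Polynomial.coeff p ` {..e}"
  have B1: "finite B1" "B1 \<subseteq> alg Z" using B0 p by (auto simp: B1_def)
  have pB1: "Polynomial.coeff p i \<in> insert 0 B1" for i
    by (cases "i \<le> e") (auto simp: B1_def e_def coeff_eq_0)
  have PB1: "Polynomial.coeff (P b) i \<in> insert 0 B1" if "b \<in> B" for b i
    using B0(6)[OF that, of i] by (auto simp: B1_def)
  obtain C :: nat where C: "\<And>D. \<exists>q U. q \<noteq> 0 \<and> finite U \<and> card U \<le> C * (D + 1) ^ r \<and>
        (\<forall>v\<in>products B1 D. q * v \<in> V.span U)" using growth_leD[OF assms(1) B1] by blast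
  show "\<exists>C::nat. \<forall>D. \<exists>q U. q \<noteq> 0 \<and> finite U \<and> card U \<le> C * (D + 1) ^ r \<and>
        (\<forall>v\<in>products B D. q * v \<in> V.span U)"
  proof (intro exI[of _ "C * (m + 1) ^ r * e"] allI)
    fix D
    \<comment> \<open>\<open>m * D\<close> reduction steps lead from degree at most
      \<open>m * D\<close> to below \<open>e\<close>, and each adds one factor: hence products of
      length \<open>D + m * D\<close>.\<close>
    obtain q U where q: "q \<noteq> 0" "finite U" "card U \<le> C * (D + m * D + 1) ^ r"
        "\<forall>v\<in>products B1 (D + m * D). q * v \<in> V.span U" using C by blast
    define W where "W = (\<lambda>(u, i). u * z ^ i) ` (U \<times> {..<e})"
    have "card W \<le> card U * e" unfolding W_def by (rule card_poly_span[OF q(2)])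
    also have "\<dots> \<le> (C * ((m + 1) * (D + 1)) ^ r) * e"
    proof (rule mult_right_mono[OF order.trans[OF q(3)]])
      show "C * (D + m * D + 1) ^ r \<le> C * ((m + 1) * (D + 1)) ^ r"
        by (intro mult_left_mono power_mono) (auto simp: algebra_simps)
    qed simp
    finally have "card W \<le> C * (m + 1) ^ r * e * (D + 1) ^ r"
      unfolding power_mult_distrib by (simp only: ac_simps)
    moreover have "(q * lead_coeff p ^ (m * D)) * v \<in> V.span W" if "v \<in> products B D" for v
    proof -
      obtain P' where P': "poly P' z = v" "Polynomial.degree P' \<le> m * D"
        "\<forall>i. Polynomial.coeff P' i \<in> V.span (products B1 D)"
        using products_as_poly[OF B0(4,5) PB1 \<open>v \<in> _\<close>] by blast
      obtain R where R: "lead_coeff p ^ (m * D) * poly P' z = poly R z"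
        "\<forall>i\<ge>e. Polynomial.coeff R i = 0"
        "\<forall>i. Polynomial.coeff R i \<in> V.span (products B1 (D + m * D))"
      proof -
        have "Polynomial.coeff P' i = 0" if "i \<ge> e + m * D" for i
          using P'(2) that \<open>e > 0\<close> by (intro coeff_eq_0) linarith
        then show thesis using pseudo_reduction[OF p(3) pB1 e_def, of "m * D" P' D] P'(3) that by blast
      qed
      have "Polynomial.degree R < e" using R(2) \<open>e > 0\<close> degree_lessI by blast
      then have "q * poly R z \<in> V.span W" unfolding W_def
        by (rule poly_span) (use R in \<open>auto intro!: span_mult_left[OF bspec[OF q(4)]]\<close>)
      then show ?thesis using R(1) P'(1) by (simp add: algebra_simps)
    qed
    moreover have "finite W" unfolding W_def by (rule card_poly_span[OF q(2)])
    moreover have "q * lead_coeff p ^ (m * D) \<noteq> 0" using q(1) p(1) by simp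
    ultimately show "\<exists>q U. q \<noteq> 0 \<and> finite U \<and> card U \<le> C * (m + 1) ^ r * e * (D + 1) ^ r \<and>
        (\<forall>v\<in>products B D. q * v \<in> V.span U)" by blast
  qed
qed

lemma growth_le_Un_algebraic:
  assumes "finite Y" "growth_le Z r" "\<And>y. y \<in> Y \<Longrightarrow> algebraic_over (alg Z) y"
  shows "growth_le (Z \<union> Y) r"
  using assms(1,3)
proof (induction Y)
  case (insert y Y)
  have "algebraic_over (alg (Z \<union> Y)) y"
    by (rule algebraic_over_mono[OF insert.prems alg_mono]) auto
  moreover have "growth_le (Z \<union> Y) r" using insert by blast
  ultimately show ?case by (simp add: growth_le_insert_algebraic)
qed (use assms(2) in simp)

lemma growth_le_Un_list:
  assumes "growth_le Z r"
  shows "growth_le (set zs \<union> Z) (length zs + r)"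
  using assms by (induction zs) (auto intro: growth_le_insert)

end

section \<open>Algebraic independence\<close>

context field_algebra
begin

text \<open>Each entry is transcendental over \<open>Z\<close> and the entries after it.\<close>

fun indep :: "'a set \<Rightarrow> 'a list \<Rightarrow> bool" where
  "indep Z [] \<longleftrightarrow> True"
| "indep Z (y # ys) \<longleftrightarrow> \<not> algebraic_over (alg (Z \<union> set ys)) y \<and> indep Z ys"

lemma indep_append: "indep Z (ys @ ts) \<longleftrightarrow> indep Z ts \<and> indep (Z \<union> set ts) ys"
  by (induction ys) (auto simp: Un_ac)

lemma indep_drop: "indep Z ys \<Longrightarrow> indep Z (drop k ys)"
  by (metis append_take_drop_id indep_append)

lemma indep_member:
  assumes "indep Z ys" "y \<in> set ys"
  shows "\<not> algebraic_over (alg Z) y"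
  using assms
proof (induction ys)
  case (Cons x ys)
  then show ?case using algebraic_over_mono[OF _ alg_mono[of Z "Z \<union> set ys"]] by auto
qed simp

lemma indep_distinct: "indep Z ys \<Longrightarrow> distinct ys"
  by (induction ys) (auto dest!: algebraic_over_alg_self[OF alg.gen[of _ "Z \<union> set _"], OF UnI2])

section \<open>Monomials and their linear relations\<close>

definition monomial :: "'a list \<Rightarrow> nat list \<Rightarrow> 'a" where
  "monomial zs as = prod_list (map2 (^) zs as)"

lemma monomial_Nil [simp]: "monomial [] as = 1" "monomial zs [] = 1"
  by (auto simp: monomial_def)

lemma monomial_Cons [simp]: "monomial (z # zs) (a # as) = z ^ a * monomial zs as"
  by (simp add: monomial_def)

lemma monomial_append:
  "length as = length ys \<Longrightarrow> monomial (ys @ zs) (as @ bs) = monomial ys as * monomial zs bs"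
  by (simp add: monomial_def)

lemma monomial_in_alg: "set zs \<subseteq> alg Z \<Longrightarrow> monomial zs as \<in> alg Z"
  by (induction zs arbitrary: as) (simp, case_tac as, auto intro: alg.mult alg_power)

lemma monomial_in_products:
  assumes "set as \<subseteq> {..D}" "length as = length zs" "insert 1 (set zs) \<subseteq> B"
  shows "monomial zs as \<in> products B (length zs * D)"
  using assms(2,1,3)
proof (induction as zs rule: list_induct2)
  case (Cons a as z zs)
  \<comment> \<open>Padding with ones gives every power the same length \<open>D\<close>.\<close>
  have "z ^ a * 1 ^ (D - a) \<in> products B (a + (D - a))"
    using Cons.prems by (intro products_mult power_in_products) auto
  then have "z ^ a \<in> products B D" using Cons.prems by simp
  then show ?case using Cons by (auto intro: products_mult)
qed simp

text \<open>Collect the relation by powers of the first entry \<open>y\<close>. The coefficients lie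
  in the algebra over which \<open>y\<close> is transcendental, so each vanishes; the one belonging
  to the first exponent of \<open>as\<close> is a relation between the remaining entries.\<close>

lemma indep_monomials:
  assumes "indep Z ys" "finite A" "\<And>as. as \<in> A \<Longrightarrow> length as = length ys"
    "\<And>as. as \<in> A \<Longrightarrow> d as \<in> alg Z" "(\<Sum>as\<in>A. d as * monomial ys as) = 0" "as \<in> A"
  shows "d as = 0"
  using assms
proof (induction ys arbitrary: A d as)
  case Nil
  then have "as = []" "A = {[]}" by auto
  with Nil show ?case by auto
next
  case (Cons y ys)
  define p where "p = (\<Sum>bs\<in>A. Polynomial.monom (d bs * monomial ys (tl bs)) (hd bs))"
  have split: "hd bs # tl bs = bs" if "bs \<in> A" for bs
    using Cons.prems(3)[OF that] by (cases bs) auto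
  have "monomial (y # ys) bs = y ^ hd bs * monomial ys (tl bs)" if "bs \<in> A" for bs
    using split[OF that] monomial_Cons by metis
  then have "poly p y = (\<Sum>as\<in>A. d as * monomial (y # ys) as)"
    unfolding p_def poly_sum poly_monom by (intro sum.cong) auto
  then have "poly p y = 0" using Cons.prems(5) by simp
  moreover have "Polynomial.coeff p i \<in> alg (Z \<union> set ys)" for i
  proof -
    have "d bs \<in> alg (Z \<union> set ys)" if "bs \<in> A" for bs
      using Cons.prems(4)[OF that] alg_mono[of Z "Z \<union> set ys"] by auto
    moreover have "monomial ys cs \<in> alg (Z \<union> set ys)" for cs
      by (intro monomial_in_alg) (auto intro: alg.gen)
    ultimately show ?thesis
      unfolding p_def coeff_sum coeff_monom by (auto intro!: alg_sum alg.mult)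
  qed
  ultimately have "p = 0" using Cons.prems(1) unfolding algebraic_over_def indep.simps by blast
  define A' where "A' = {cs. hd as # cs \<in> A}"
  have A: "{bs \<in> A. hd bs = hd as} = (#) (hd as) ` A'"
    using split by (auto simp: A'_def image_iff) metis
  have fin: "finite A'"
    unfolding A'_def using finite_vimageI[OF Cons.prems(2), of "(#) (hd as)"]
    by (simp add: vimage_def inj_on_def)
  have "0 = Polynomial.coeff p (hd as)" using \<open>p = 0\<close> by simp
  also have "\<dots> = (\<Sum>bs\<in>A. if hd bs = hd as then d bs * monomial ys (tl bs) else 0)"
    by (simp add: p_def coeff_sum coeff_monom)
  also have "\<dots> = (\<Sum>bs\<in>{bs \<in> A. hd bs = hd as}. d bs * monomial ys (tl bs))"
    using Cons.prems(2) by (intro sum.inter_filter[symmetric])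
  also have "\<dots> = (\<Sum>cs\<in>A'. d (hd as # cs) * monomial ys cs)"
    unfolding A by (subst sum.reindex) (auto simp: inj_on_def)
  finally have 0: "(\<Sum>cs\<in>A'. d (hd as # cs) * monomial ys cs) = 0" ..
  have len: "length cs = length ys" if "cs \<in> A'" for cs
    using Cons.prems(3)[of "hd as # cs"] that by (simp add: A'_def)
  have dZ: "d (hd as # cs) \<in> alg Z" if "cs \<in> A'" for cs
    using Cons.prems(4)[of "hd as # cs"] that by (simp add: A'_def)
  have "tl as \<in> A'" using split[OF Cons.prems(6)] Cons.prems(6) by (simp add: A'_def)
  with Cons.IH[OF _ fin len dZ 0] Cons.prems(1) have "d (hd as # tl as) = 0" by auto
  then show ?case using split[OF Cons.prems(6)] by simp
qed

text \<open>The dimension bound concerns sets, so a family with \<open>f a = f b\<close> for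
  distinct indices is treated apart; there the coefficients 1 and -1 give the relation.\<close>

lemma dependent_family:
  assumes "finite A" "finite U" "card U < card A" "\<And>a. a \<in> A \<Longrightarrow> f a \<in> V.span U"
  obtains c where "(\<Sum>a\<in>A. \<iota> (c a) * f a) = 0" "\<exists>a\<in>A. c a \<noteq> 0"
proof (cases "inj_on f A")
  case True
  have "V.dependent (f ` A)"
  proof (rule ccontr)
    assume "V.independent (f ` A)"
    moreover have "f ` A \<subseteq> V.span U" using assms(4) by auto
    ultimately have "card (f ` A) \<le> card U" using V.independent_span_bound[OF assms(2)] by blast
    then show False using card_image[OF True] assms(3) by simp
  qed
  then obtain u where u: "\<exists>v\<in>f ` A. u v \<noteq> 0" "(\<Sum>v\<in>f ` A. \<iota> (u v) * v) = 0"
    using V.dependent_finite[of "f ` A"] assms(1) by auto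
  from u(2) have "(\<Sum>a\<in>A. \<iota> (u (f a)) * f a) = 0" by (simp add: sum.reindex[OF True])
  then show thesis using u(1) by (intro that[of "u \<circ> f"]) auto
next
  case False
  then obtain a b where ab: "a \<in> A" "b \<in> A" "a \<noteq> b" "f a = f b" by (auto simp: inj_on_def)
  define c :: "'b \<Rightarrow> 'f" where "c x = (if x = a then 1 else if x = b then - 1 else 0)" for x
  have "(\<Sum>x\<in>A. \<iota> (c x) * f x) = (\<Sum>x\<in>{a, b}. \<iota> (c x) * f x)"
    using ab assms(1) by (intro sum.mono_neutral_right) (auto simp: c_def)
  also have "\<dots> = 0" using ab by (simp add: c_def \<iota>_minus)
  finally show thesis using ab by (intro that[of c]) (auto simp: c_def)
qed

text \<open>Exponents in a box have \<open>r + 1\<close> degrees of freedom against the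
  \<open>r\<close> that growth allows, so there are more monomials than dimensions; the multiplier
  \<open>q\<close> cancels in a domain.\<close>

lemma growth_le_dependent:
  assumes "growth_le Z r" "set hs \<subseteq> alg Z" "length hs = Suc r"
  obtains A c where "finite A" "\<And>as. as \<in> A \<Longrightarrow> length as = length hs"
    "(\<Sum>as\<in>A. \<iota> (c as) * monomial hs as) = 0" "\<exists>as\<in>A. c as \<noteq> 0"
proof -
  define B where "B = insert 1 (set hs)"
  obtain C :: nat where C: "\<And>D. \<exists>q U. q \<noteq> 0 \<and> finite U \<and> card U \<le> C * (D + 1) ^ r \<and>
        (\<forall>v\<in>products B D. q * v \<in> V.span U)"
    using growth_leD[OF assms(1), of B] assms(2) by (auto simp: B_def)
  define n where "n = Suc r"
  \<comment> \<open>Makes \<open>C * (n * (D + 1)) ^ r\<close> equal to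
    \<open>D * (D + 1) ^ r\<close>, which falls just short of the number
    \<open>(D + 1) ^ Suc r\<close> of exponent vectors.\<close>
  define D where "D = C * n ^ r"
  define A where "A = {as. set as \<subseteq> {..D} \<and> length as = n}"
  obtain q U where q: "q \<noteq> 0" "finite U" "card U \<le> C * (n * D + 1) ^ r"
    "\<forall>v\<in>products B (n * D). q * v \<in> V.span U" using C by blast
  have A: "finite A" "card A = (D + 1) ^ n"
    unfolding A_def using finite_lists_length_eq[of "{..D}" n] card_lists_length_eq[of "{..D}" n] by auto
  have "C * (n * D + 1) ^ r \<le> C * (n * (D + 1)) ^ r"
    by (intro mult_left_mono power_mono) (auto simp: n_def)
  also have "\<dots> = D * (D + 1) ^ r" by (simp only: D_def power_mult_distrib ac_simps)
  also have "\<dots> < (D + 1) * (D + 1) ^ r" by (intro mult_strict_right_mono) auto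
  finally have "card U < card A" using q(3) A(2) by (simp add: n_def)
  moreover have "q * monomial hs as \<in> V.span U" if "as \<in> A" for as
    using monomial_in_products[of as D hs B] that q(4) assms(3) by (auto simp: A_def B_def n_def)
  ultimately obtain c where c: "(\<Sum>as\<in>A. \<iota> (c as) * (q * monomial hs as)) = 0" "\<exists>as\<in>A. c as \<noteq> 0"
    using dependent_family[OF A(1) q(2), of "\<lambda>as. q * monomial hs as"] by blast
  have "q * (\<Sum>as\<in>A. \<iota> (c as) * monomial hs as) = 0"
    using c(1) by (simp add: sum_distrib_left mult.left_commute)
  then have "(\<Sum>as\<in>A. \<iota> (c as) * monomial hs as) = 0" using q(1) by simp
  from that[OF A(1) _ this c(2)] show thesis using assms(3) by (simp add: A_def n_def)
qed

text \<open>Here the two bounds of transcendence degree meet: any \<open>r + 1\<close> elements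
  satisfy a nontrivial relation with constant coefficients, which \<open>indep_monomials\<close>
  excludes.\<close>

lemma indep_length_le:
  assumes "growth_le Z r" "set hs \<subseteq> alg Z" "indep Y hs"
  shows "length hs \<le> r"
proof (rule ccontr)
  assume "\<not> length hs \<le> r"
  \<comment> \<open>Entries are removed from the front, since each refers only to those after it and
    the tail stays independent.\<close>
  define hs' where "hs' = drop (length hs - Suc r) hs"
  have hs': "length hs' = Suc r" "set hs' \<subseteq> alg Z" "indep Y hs'"
    using \<open>\<not> _\<close> assms set_drop_subset[of "length hs - Suc r" hs]
    by (auto simp: hs'_def indep_drop)
  obtain A c where A: "finite A" "\<And>as. as \<in> A \<Longrightarrow> length as = length hs'"
    "(\<Sum>as\<in>A. \<iota> (c as) * monomial hs' as) = 0" "\<exists>as\<in>A. c as \<noteq> 0"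
    using growth_le_dependent[OF assms(1) hs'(2,1)] by blast
  then obtain as where "as \<in> A" "c as \<noteq> 0" by blast
  with indep_monomials[OF hs'(3) A(1,2) alg.const A(3)] show False by simp
qed

lemma growth_le_set: "growth_le (set zs) (length zs)"
  using growth_le_Un_list[OF growth_le_empty, of zs] by simp

text \<open>Greedy selection. New members are put in front, so \<open>ts\<close> survives as the
  tail and transcendence is required of the newcomer alone.\<close>

lemma indep_extend:
  assumes "finite Y" "indep Z ts"
  shows "\<exists>ys. set ys \<subseteq> Y \<and> indep Z (ys @ ts) \<and>
    (\<forall>y\<in>Y. algebraic_over (alg (Z \<union> set ys \<union> set ts)) y)"
  using assms(1)
proof (induction Y)
  case empty
  then show ?case using assms(2) by (intro exI[of _ "[]"]) auto
next
  case (insert y Y)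
  then obtain ys where ys: "set ys \<subseteq> Y" "indep Z (ys @ ts)"
    "\<forall>y\<in>Y. algebraic_over (alg (Z \<union> set ys \<union> set ts)) y" by blast
  show ?case
  proof (cases "algebraic_over (alg (Z \<union> set ys \<union> set ts)) y")
    case True
    with ys show ?thesis by (intro exI[of _ ys]) auto
  next
    case False
    have "alg (Z \<union> set ys \<union> set ts) \<subseteq> alg (Z \<union> set (y # ys) \<union> set ts)"
      by (intro alg_mono) auto
    moreover have "algebraic_over (alg (Z \<union> set (y # ys) \<union> set ts)) y"
      by (intro algebraic_over_alg_self alg.gen) auto
    ultimately show ?thesis using ys False algebraic_over_mono
      by (intro exI[of _ "y # ys"]) (auto simp: Un_assoc)
  qed
qed

section \<open>Algebra homomorphisms and chains of their kernels\<close>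

definition alg_hom :: "('a \<Rightarrow> 'a) \<Rightarrow> bool" where
  "alg_hom \<phi> \<longleftrightarrow> (\<forall>a b. \<phi> (a + b) = \<phi> a + \<phi> b) \<and> (\<forall>a b. \<phi> (a * b) = \<phi> a * \<phi> b) \<and>
     (\<forall>c. \<phi> (\<iota> c) = \<iota> c)"

lemma alg_hom_add: "alg_hom \<phi> \<Longrightarrow> \<phi> (a + b) = \<phi> a + \<phi> b"
  and alg_hom_mult: "alg_hom \<phi> \<Longrightarrow> \<phi> (a * b) = \<phi> a * \<phi> b"
  and alg_hom_const: "alg_hom \<phi> \<Longrightarrow> \<phi> (\<iota> c) = \<iota> c"
  by (auto simp: alg_hom_def)

lemma alg_hom_0: "alg_hom \<phi> \<Longrightarrow> \<phi> 0 = 0"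
  using alg_hom_const[of \<phi> 0] by simp

lemma alg_hom_1: "alg_hom \<phi> \<Longrightarrow> \<phi> 1 = 1"
  using alg_hom_const[of \<phi> 1] by simp

lemma alg_hom_id: "alg_hom (\<lambda>x. x)"
  by (simp add: alg_hom_def)

lemma alg_hom_comp: "alg_hom \<phi> \<Longrightarrow> alg_hom \<psi> \<Longrightarrow> alg_hom (\<psi> \<circ> \<phi>)"
  by (simp add: alg_hom_def)

lemma alg_hom_poly: "alg_hom \<phi> \<Longrightarrow> \<phi> (poly p x) = poly (map_poly \<phi> p) (\<phi> x)"
  by (induction p) (auto simp: alg_hom_0 alg_hom_add alg_hom_mult map_poly_pCons)

lemma alg_hom_alg:
  assumes "alg_hom \<phi>"
  shows "\<phi> ` alg Z = alg (\<phi> ` Z)"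
proof (intro equalityI subsetI)
  fix x assume "x \<in> \<phi> ` alg Z"
  then obtain a where "a \<in> alg Z" "x = \<phi> a" by blast
  from this(1) have "\<phi> a \<in> alg (\<phi> ` Z)"
    by induction (use assms in \<open>auto simp: alg_hom_def intro: alg.intros\<close>)
  with \<open>x = \<phi> a\<close> show "x \<in> alg (\<phi> ` Z)" by simp
next
  fix x assume "x \<in> alg (\<phi> ` Z)"
  then show "x \<in> \<phi> ` alg Z"
  proof induction
    case (const c)
    then show ?case using alg_hom_const[OF assms, of c] alg.const by (metis image_eqI)
  next
    case (add a b)
    then obtain a' b' where "a = \<phi> a'" "b = \<phi> b'" "a' \<in> alg Z" "b' \<in> alg Z" by blast
    then show ?case using alg.add alg_hom_add[OF assms] by (metis image_eqI)
  next
    case (mult a b)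
    then obtain a' b' where "a = \<phi> a'" "b = \<phi> b'" "a' \<in> alg Z" "b' \<in> alg Z" by blast
    then show ?case using alg.mult alg_hom_mult[OF assms] by (metis image_eqI)
  qed (auto intro: alg.gen)
qed

lemma alg_hom_fixes:
  assumes "alg_hom \<phi>" "\<And>z. z \<in> Z \<Longrightarrow> \<phi> z = z" "a \<in> alg Z"
  shows "\<phi> a = a"
  using assms(3) by induction (use assms(1,2) in \<open>auto simp: alg_hom_def\<close>)

text \<open>Applying \<open>\<phi>\<close> to a relation may turn it into the zero polynomial; a
  leading coefficient that survives rules this out.\<close>

lemma algebraic_over_image:
  assumes "alg_hom \<phi>" "\<And>i. Polynomial.coeff p i \<in> alg Z" "\<phi> (poly p z) = 0" "\<phi> (lead_coeff p) \<noteq> 0"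
  shows "algebraic_over (alg (\<phi> ` Z)) (\<phi> z)"
  unfolding algebraic_over_def
proof (intro exI[of _ "map_poly \<phi> p"] conjI allI)
  show "map_poly \<phi> p \<noteq> 0"
    using assms(1,4) by (metis alg_hom_0 coeff_0 coeff_map_poly)
  show "Polynomial.coeff (map_poly \<phi> p) i \<in> alg (\<phi> ` Z)" for i
    using assms(2) alg_hom_alg[OF assms(1)] by (auto simp: coeff_map_poly alg_hom_0[OF assms(1)])
  show "poly (map_poly \<phi> p) (\<phi> z) = 0"
    using assms(3) by (simp add: alg_hom_poly[OF assms(1)])
qed

text \<open>With equal kernels on \<open>alg F\<close> the two images are isomorphic. Concretely, a
  relation between the images under \<open>\<psi>\<close> is lifted to \<open>alg F\<close> and
  pushed down by \<open>\<phi>\<close>.\<close>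

lemma indep_transfer:
  assumes "alg_hom \<phi>" "alg_hom \<psi>" "\<And>a. a \<in> alg F \<Longrightarrow> \<phi> a = 0 \<longleftrightarrow> \<psi> a = 0"
    "set xs \<subseteq> alg F" "indep {} (map \<phi> xs)"
  shows "indep {} (map \<psi> xs)"
  using assms(4,5)
proof (induction xs)
  case (Cons x xs)
  have "\<not> algebraic_over (alg (\<psi> ` set xs)) (\<psi> x)"
  proof
    assume "algebraic_over (alg (\<psi> ` set xs)) (\<psi> x)"
    then obtain p where p: "p \<noteq> 0" "\<And>i. Polynomial.coeff p i \<in> \<psi> ` alg (set xs)" "poly p (\<psi> x) = 0"
      unfolding algebraic_over_def alg_hom_alg[OF assms(2)] by blast
    then have "\<forall>i. \<exists>b. b \<in> alg (set xs) \<and> \<psi> b = Polynomial.coeff p i" by (metis imageE)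
    then obtain c where c: "\<And>i. c i \<in> alg (set xs)" "\<And>i. \<psi> (c i) = Polynomial.coeff p i"
      by metis
    \<comment> \<open>Cut off at the degree of \<open>p\<close>: beyond it the chosen lifts of 0
      need not vanish.\<close>
    define p' where "p' = (\<Sum>i\<le>Polynomial.degree p. Polynomial.monom (c i) i)"
    have cp': "Polynomial.coeff p' i = (if i \<le> Polynomial.degree p then c i else 0)" for i
      by (simp add: p'_def coeff_sum coeff_monom)
    have "map_poly \<psi> p' = p"
      by (intro poly_eqI) (auto simp: coeff_map_poly cp' c alg_hom_0[OF assms(2)] coeff_eq_0)
    then have "\<psi> (poly p' x) = 0" using p(3) by (simp add: alg_hom_poly[OF assms(2)])
    have xsF: "alg (set xs) \<subseteq> alg F" using Cons.prems(1) by (simp add: alg_subset_iff)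
    have in_xs: "Polynomial.coeff p' i \<in> alg (set xs)" for i by (auto simp: cp' c)
    then have "poly p' x \<in> alg F" using xsF Cons.prems(1) by (intro poly_in_alg) auto
    then have 1: "\<phi> (poly p' x) = 0" using assms(3) \<open>\<psi> _ = 0\<close> by blast
    have lead: "\<psi> (c (Polynomial.degree p)) \<noteq> 0" using c(2) p(1) by simp
    then have "c (Polynomial.degree p) \<noteq> 0" using alg_hom_0[OF assms(2)] by auto
    then have "Polynomial.degree p' = Polynomial.degree p"
      by (intro antisym degree_le le_degree) (auto simp: cp')
    then have "\<phi> (lead_coeff p') \<noteq> 0"
      using lead assms(3) c(1) xsF by (auto simp: cp')
    with algebraic_over_image[OF assms(1) in_xs 1] Cons.prems(2) show False by simp
  qed
  with Cons show ?case by simp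
qed simp

text \<open>
  The variable \<open>x\<close> is sent to a power of another variable rather than to a constant, because all
  constants may be roots of the polynomials to be avoided when the field is finite.
\<close>

lemma specialize_variable:
  assumes hom: "\<And>a. \<exists>\<psi>. alg_hom \<psi> \<and> \<psi> x = a \<and> (\<forall>y\<in>set xs. \<psi> y = y)"
    and xs: "indep {} (x # xs)" and ts: "set ts \<subseteq> alg (set (x # xs))" "indep {} ts"
  obtains \<psi> ts' where "alg_hom \<psi>" "\<psi> ` alg (set (x # xs)) \<subseteq> alg (set xs)"
    "set ts' \<subseteq> \<psi> ` set ts" "indep {} ts'" "length ts \<le> Suc (length ts')"
proof (cases xs)
  case Nil
  obtain \<psi> where \<psi>: "alg_hom \<psi>" "\<psi> x = 0" using hom by blast
  have "length ts \<le> length [x]"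
    using ts Nil by (intro indep_length_le[OF growth_le_set]) auto
  moreover have "\<psi> ` alg (set (x # xs)) \<subseteq> alg (set xs)"
    using alg_hom_alg[OF \<psi>(1), of "set (x # xs)"] \<psi>(2) Nil by (simp add: alg_subset_iff)
  ultimately show thesis using that[of \<psi> "[]"] \<psi> by simp
next
  case (Cons x1 xs')
  define W where "W = set (x # xs)"
  have xsW: "alg (set xs) \<subseteq> alg W" unfolding W_def by (rule alg_mono) auto
  \<comment> \<open>\<open>ys\<close> completes \<open>ts\<close> so that all variables are
    algebraic over the two together; the loss in \<open>ts\<close> can then be measured by counting
    variables.\<close>
  obtain ys where ys: "set ys \<subseteq> W" "indep {} (ys @ ts)"
    "\<forall>y\<in>W. algebraic_over (alg (set ys \<union> set ts)) y"
    using indep_extend[OF _ ts(2), of W] by (auto simp: W_def)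
  have ysts: "alg (set ys \<union> set ts) \<subseteq> alg W"
    using ys(1) ts(1) by (auto simp: alg_subset_iff W_def intro: alg.gen)
  have len1: "length (ys @ ts) \<le> length (x # xs)"
    using ysts ys by (intro indep_length_le[OF growth_le_set]) (auto simp: W_def alg_subset_iff)
  have "\<forall>y\<in>W. \<exists>p. p \<noteq> 0 \<and> (\<forall>i. Polynomial.coeff p i \<in> alg (set ys \<union> set ts)) \<and> poly p y = 0"
    using ys(3) by (simp add: algebraic_over_def)
  then obtain p where p: "\<And>y. y \<in> W \<Longrightarrow> p y \<noteq> 0" "\<And>y. y \<in> W \<Longrightarrow> poly (p y) y = 0"
    "\<And>y i. y \<in> W \<Longrightarrow> Polynomial.coeff (p y) i \<in> alg (set ys \<union> set ts)" by metis
  \<comment> \<open>Written as polynomials in \<open>x\<close>, the leading coefficients survive the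
    substitution of a value for \<open>x\<close> unless that value is one of their roots.\<close>
  have "\<exists>P. (\<forall>i. Polynomial.coeff P i \<in> alg (set xs)) \<and> poly P x = lead_coeff (p y)" if "y \<in> W" for y
    using alg_insertE[of "lead_coeff (p y)" x "set xs"] p(3)[OF that] ysts
    by (metis W_def list.simps(15) subsetD)
  then obtain P where P: "\<And>y i. y \<in> W \<Longrightarrow> Polynomial.coeff (P y) i \<in> alg (set xs)"
    "\<And>y. y \<in> W \<Longrightarrow> poly (P y) x = lead_coeff (p y)" by metis
  have P0: "P y \<noteq> 0" if "y \<in> W" for y using P(2)[OF that] p(1)[OF that] by auto
  define bad where "bad = (\<Union>y\<in>W. {a. poly (P y) a = 0})"
  have "finite bad" unfolding bad_def W_def
    by (intro finite_UN_I finite_set poly_roots_finite) (use P0 W_def in auto)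
  moreover have "inj (\<lambda>k::nat. x1 ^ k)"
  proof (rule injI, rule ccontr)
    fix j k :: nat assume jk: "x1 ^ j = x1 ^ k" "j \<noteq> k"
    have "algebraic_over (alg {}) x1"
      unfolding algebraic_over_def
    proof (intro exI[of _ "Polynomial.monom 1 j - Polynomial.monom 1 k"] conjI allI)
      show "Polynomial.monom 1 j - Polynomial.monom 1 k \<noteq> (0 :: 'a poly)"
        using jk(2) by (simp add: monom_eq_iff')
      show "Polynomial.coeff (Polynomial.monom 1 j - Polynomial.monom 1 k) i \<in> alg {}" for i
        by (auto simp: coeff_monom intro: alg_uminus)
    qed (use jk(1) in \<open>simp add: poly_monom\<close>)
    then show False using indep_member[OF xs, of x1] Cons by simp
  qed
  then have "infinite (range (\<lambda>k::nat. x1 ^ k))" by (simp add: finite_image_iff)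
  ultimately obtain k where k: "x1 ^ k \<notin> bad"
    by (metis (no_types, lifting) finite_subset image_subsetI)
  obtain \<psi> where \<psi>: "alg_hom \<psi>" "\<psi> x = x1 ^ k" "\<And>y. y \<in> set xs \<Longrightarrow> \<psi> y = y" using hom by blast
  have "x1 \<in> alg (set xs)" using Cons by (auto intro: alg.gen)
  then have 1: "\<psi> ` alg (set (x # xs)) \<subseteq> alg (set xs)"
    unfolding alg_hom_alg[OF \<psi>(1)] alg_subset_iff using \<psi> by (auto intro: alg.gen alg_power)
  have alg\<psi>: "algebraic_over (alg (\<psi> ` (set ys \<union> set ts))) (\<psi> y)" if y: "y \<in> W" for y
  proof (rule algebraic_over_image[OF \<psi>(1) p(3)[OF y]])
    have "map_poly \<psi> (P y) = P y"
      using P(1)[OF y] alg_hom_fixes[OF \<psi>(1), of "set xs"] \<psi>(3)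
      by (intro poly_eqI) (auto simp: coeff_map_poly alg_hom_0[OF \<psi>(1)])
    then have "\<psi> (lead_coeff (p y)) = poly (P y) (x1 ^ k)"
      using P(2)[OF y] \<psi>(2) alg_hom_poly[OF \<psi>(1), of "P y" x] by simp
    then show "\<psi> (lead_coeff (p y)) \<noteq> 0" using k y by (auto simp: bad_def)
  qed (simp add: p(2)[OF y] alg_hom_0[OF \<psi>(1)])
  obtain ts' where ts': "set ts' \<subseteq> \<psi> ` set ts" "indep {} ts'"
    "\<forall>y\<in>\<psi> ` set ts. algebraic_over (alg (set ts')) y"
    using indep_extend[of "\<psi> ` set ts" "{}" "[]"] by auto
  have "growth_le (set ts' \<union> \<psi> ` set ts) (length ts')"
    using ts'(3) by (intro growth_le_Un_algebraic[OF _ growth_le_set]) auto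
  from growth_le_Un_list[OF this, of "map \<psi> ys"]
  have g: "growth_le (\<psi> ` set ys \<union> (set ts' \<union> \<psi> ` set ts)) (length ys + length ts')" by simp
  \<comment> \<open>The remaining variables are algebraic over the images of \<open>ys\<close> and
    \<open>ts\<close>, so \<open>xs\<close> has at most \<open>length ys + length ts'\<close>
    entries. As \<open>ys @ ts\<close> has at most one entry more than \<open>xs\<close>, the loss
    is at most one.\<close>
  have "growth_le (\<psi> ` set ys \<union> (set ts' \<union> \<psi> ` set ts) \<union> set xs) (length ys + length ts')"
  proof (rule growth_le_Un_algebraic[OF _ g])
    fix y assume y: "y \<in> set xs"
    then have "algebraic_over (alg (\<psi> ` (set ys \<union> set ts))) y"
      using alg\<psi>[of y] \<psi>(3) by (auto simp: W_def)
    then show "algebraic_over (alg (\<psi> ` set ys \<union> (set ts' \<union> \<psi> ` set ts))) y"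
      by (rule algebraic_over_mono) (auto intro!: alg_mono)
  qed simp
  then have "length xs \<le> length ys + length ts'"
    using xs by (intro indep_length_le[of _ _ xs "{}"]) (auto intro: alg.gen)
  then show thesis using that[OF \<psi>(1) 1 ts'(1,2)] len1 by simp
qed

definition hom_kernel :: "'a set \<Rightarrow> ('a \<Rightarrow> 'a) \<Rightarrow> 'a set" where
  "hom_kernel F \<phi> = {a \<in> alg F. \<phi> a = 0}"

text \<open>Induction on the variables that may occur in the image of \<open>\<phi>\<close>;
  \<open>specialize_variable\<close> eliminates one. If the new images of \<open>F\<close> still
  contain \<open>length ts\<close> independent elements, the chain of the induction hypothesis is
  long enough, and only its bottom is exchanged for the smaller kernel of \<open>\<phi>\<close>.
  Otherwise \<open>indep_transfer\<close> shows that the kernel has grown, and that of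
  \<open>\<phi>\<close> goes below the chain. Prescribing \<open>Q 0\<close> makes this gluing
  possible.\<close>

lemma kernel_chain:
  assumes hom: "\<And>x a. x \<in> W \<Longrightarrow> \<exists>\<psi>. alg_hom \<psi> \<and> \<psi> x = a \<and> (\<forall>y\<in>W - {x}. \<psi> y = y)"
    and "set xs \<subseteq> W" "indep {} xs"
    "alg_hom \<phi>" "\<phi> ` alg F \<subseteq> alg (set xs)" "set ts \<subseteq> \<phi> ` F" "indep {} ts"
  shows "\<exists>Q. Q 0 = hom_kernel F \<phi> \<and> (\<forall>i\<le>length ts. \<exists>\<psi>. alg_hom \<psi> \<and> Q i = hom_kernel F \<psi>) \<and>
    (\<forall>i<length ts. Q i \<subset> Q (Suc i))"
  using assms(2-)
proof (induction xs arbitrary: \<phi> ts)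
  case Nil
  have "set ts \<subseteq> alg (set [])" using Nil.prems(4,5) by (blast intro: alg.gen)
  then have "length ts \<le> 0"
    using Nil.prems(6) growth_le_empty by (metis indep_length_le list.set(1))
  then show ?case using Nil.prems(3) by (intro exI[of _ "\<lambda>_. hom_kernel F \<phi>"]) auto
next
  case (Cons x xs)
  have tsW: "set ts \<subseteq> alg (set (x # xs))" using Cons.prems(4,5) by (blast intro: alg.gen)
  have "\<exists>\<psi>. alg_hom \<psi> \<and> \<psi> x = a \<and> (\<forall>y\<in>set xs. \<psi> y = y)" for a
  proof -
    have "set xs \<subseteq> W - {x}" using indep_distinct[OF Cons.prems(2)] Cons.prems(1) by auto
    then show ?thesis using hom[of x a] Cons.prems(1) by (metis list.set_intros(1) subset_iff)
  qed
  from specialize_variable[OF this Cons.prems(2) tsW Cons.prems(6)]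
  obtain \<psi> ts' where \<psi>: "alg_hom \<psi>" "\<psi> ` alg (set (x # xs)) \<subseteq> alg (set xs)"
    "set ts' \<subseteq> \<psi> ` set ts" "indep {} ts'" "length ts \<le> Suc (length ts')" .
  define \<phi>' where "\<phi>' = \<psi> \<circ> \<phi>"
  have h: "alg_hom \<phi>'" unfolding \<phi>'_def by (rule alg_hom_comp[OF Cons.prems(3) \<psi>(1)])
  have r: "\<phi>' ` alg F \<subseteq> alg (set xs)"
    using \<psi>(2) Cons.prems(4) unfolding \<phi>'_def image_comp[symmetric] by blast
  have sub: "hom_kernel F \<phi> \<subseteq> hom_kernel F \<phi>'"
    by (auto simp: hom_kernel_def \<phi>'_def alg_hom_0[OF \<psi>(1)])
  have xsW: "set xs \<subseteq> W" "indep {} xs" using Cons.prems by auto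
  note IH = Cons.IH[OF xsW h r]
  show ?case
  proof (cases "\<exists>us. set us \<subseteq> \<phi>' ` F \<and> indep {} us \<and> length us = length ts")
    case True
    then obtain us where us: "set us \<subseteq> \<phi>' ` F" "indep {} us" "length us = length ts" by blast
    obtain Q where Q: "Q 0 = hom_kernel F \<phi>'"
      "\<forall>i\<le>length ts. \<exists>\<psi>. alg_hom \<psi> \<and> Q i = hom_kernel F \<psi>" "\<forall>i<length ts. Q i \<subset> Q (Suc i)"
      using IH[OF us(1,2)] us(3) by auto
    show ?thesis
    proof (intro exI[of _ "Q(0 := hom_kernel F \<phi>)"] conjI allI impI)
      show "(Q(0 := hom_kernel F \<phi>)) i \<subset> (Q(0 := hom_kernel F \<phi>)) (Suc i)" if "i < length ts" for i
        using Q(1) Q(3)[rule_format, OF that] sub by (cases i) auto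
    qed (use Q Cons.prems(3) in auto)
  next
    case False
    have "set ts' \<subseteq> \<phi>' ` F"
      using \<psi>(3) Cons.prems(5) unfolding \<phi>'_def image_comp[symmetric] by blast
    have "length ts' < length ts"
    proof (rule ccontr)
      assume "\<not> length ts' < length ts"
      then show False
        using False \<open>set ts' \<subseteq> \<phi>' ` F\<close> indep_drop[OF \<psi>(4), of "length ts' - length ts"]
          set_drop_subset[of "length ts' - length ts" ts']
        by (metis diff_diff_cancel length_drop linorder_not_less order.trans)
    qed
    with \<psi>(5) have len: "length ts = Suc (length ts')" by simp
    obtain Q where Q: "Q 0 = hom_kernel F \<phi>'"
      "\<forall>i\<le>length ts'. \<exists>\<psi>. alg_hom \<psi> \<and> Q i = hom_kernel F \<psi>" "\<forall>i<length ts'. Q i \<subset> Q (Suc i)"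
      using IH[OF \<open>set ts' \<subseteq> \<phi>' ` F\<close> \<psi>(4)] by auto
    have "hom_kernel F \<phi> \<noteq> hom_kernel F \<phi>'"
    proof
      assume eq: "hom_kernel F \<phi> = hom_kernel F \<phi>'"
      have "\<forall>t\<in>set ts. \<exists>f\<in>F. \<phi> f = t" using Cons.prems(5) by blast
      then obtain g where g: "\<And>t. t \<in> set ts \<Longrightarrow> g t \<in> F" "\<And>t. t \<in> set ts \<Longrightarrow> \<phi> (g t) = t" by metis
      obtain fs where fs: "set fs \<subseteq> F" "ts = map \<phi> fs"
        using g by (intro that[of "map g ts"]) (auto simp: map_idI)
      have "indep {} (map \<phi>' fs)"
        by (rule indep_transfer[OF Cons.prems(3) h])
          (use eq fs Cons.prems(6) in \<open>auto simp: hom_kernel_def intro: alg.gen\<close>)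
      then show False using False fs by (metis image_mono length_map set_map)
    qed
    with sub have strict: "hom_kernel F \<phi> \<subset> hom_kernel F \<phi>'" by blast
    show ?thesis
    proof (intro exI[of _ "case_nat (hom_kernel F \<phi>) Q"] conjI allI impI)
      show "\<exists>\<psi>. alg_hom \<psi> \<and> case_nat (hom_kernel F \<phi>) Q i = hom_kernel F \<psi>" if "i \<le> length ts" for i
        using that Q(2) Cons.prems(3) len by (cases i) auto
      show "case_nat (hom_kernel F \<phi>) Q i \<subset> case_nat (hom_kernel F \<phi>) Q (Suc i)" if "i < length ts" for i
        using that Q strict len by (cases i) auto
    qed simp
  qed
qed

section \<open>Upper bound for chains of primes in a subalgebra\<close>

definition prime_in :: "'a set \<Rightarrow> 'a set \<Rightarrow> bool" where
  "prime_in A P \<longleftrightarrow> P \<subseteq> A \<and> 0 \<in> P \<and> 1 \<notin> P \<and> (\<forall>a\<in>P. \<forall>b\<in>P. a + b \<in> P) \<and>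
     (\<forall>a\<in>A. \<forall>b\<in>P. a * b \<in> P) \<and> (\<forall>a\<in>A. \<forall>b\<in>A. a * b \<in> P \<longrightarrow> a \<in> P \<or> b \<in> P)"

lemma prime_in_hom_kernel: "alg_hom \<phi> \<Longrightarrow> prime_in (alg F) (hom_kernel F \<phi>)"
  by (auto simp: prime_in_def hom_kernel_def alg_hom_0 alg_hom_1 alg_hom_add alg_hom_mult
      intro: alg.intros)

lemma prime_in_sum: "prime_in A P \<Longrightarrow> (\<And>i. i \<in> I \<Longrightarrow> f i \<in> P) \<Longrightarrow> sum f I \<in> P"
  by (induction I rule: infinite_finite_induct) (auto simp: prime_in_def)

text \<open>Peel off the lexicographically least exponent of the relation, one variable at a time.\<close>

lemma prime_chain_relation:
  assumes "\<And>i. i \<le> d \<Longrightarrow> prime_in (alg Z) (P i)" "\<And>i. i < d \<Longrightarrow> x i \<in> P (Suc i) - P i"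
    and sub: "\<And>i. i < d \<Longrightarrow> P i \<subseteq> P (Suc i)"
    and "k + length hs = d" "hs = map x [k..<d]"
    and "finite A" "A \<noteq> {}" "\<And>as. as \<in> A \<Longrightarrow> length as = length hs" "\<And>as. as \<in> A \<Longrightarrow> c as \<noteq> 0"
    and "(\<Sum>as\<in>A. \<iota> (c as) * monomial hs as) \<in> P k"
  shows False
  using assms(4-)
proof (induction hs arbitrary: k A c)
  case Nil
  then have A: "A = {[]}" by auto
  have P: "prime_in (alg Z) (P k)" using assms(1)[of k] Nil.prems(1) by simp
  have c: "c [] \<noteq> 0" "\<iota> (c []) \<in> P k" using Nil.prems A by auto
  then have "\<iota> (inverse (c [])) * \<iota> (c []) \<in> P k"
    using P alg.const unfolding prime_in_def by blast
  then have "1 \<in> P k" using c(1) by (simp flip: \<iota>_mult)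
  with P show False by (simp add: prime_in_def)
next
  case (Cons h hs)
  have k: "k < d" "h = x k" "hs = map x [Suc k..<d]"
    using Cons.prems(1,2) by (auto simp: upt_rec[of k d] split: if_splits)
  have P: "prime_in (alg Z) (P k)" "prime_in (alg Z) (P (Suc k))"
    using assms(1) k(1) by auto
  have xZ: "x i \<in> alg Z" if "i < d" for i
    using assms(2)[OF that] assms(1)[of "Suc i"] that by (auto simp: prime_in_def)
  have h: "h \<in> P (Suc k)" "h \<notin> P k" "h \<in> alg Z" using assms(2) xZ k by auto
  have hsZ: "monomial hs as \<in> alg Z" for as
    using xZ k(3) by (intro monomial_in_alg) auto
  define m where "m = Min (hd ` A)"
  have m: "m \<in> hd ` A" "\<And>as. as \<in> A \<Longrightarrow> m \<le> hd as"
    unfolding m_def using Cons.prems(3,4) by auto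
  have split: "hd as # tl as = as" if "as \<in> A" for as
    using Cons.prems(5)[OF that] by (cases as) auto
  define S where "S as = \<iota> (c as) * (h ^ (hd as - m) * monomial hs (tl as))" for as
  have SZ: "S as \<in> alg Z" for as
    unfolding S_def using h(3) hsZ by (intro alg.mult alg.const alg_power)
  have "monomial (h # hs) as = h ^ m * (h ^ (hd as - m) * monomial hs (tl as))" if "as \<in> A" for as
  proof -
    have "monomial (h # hs) as = h ^ hd as * monomial hs (tl as)"
      using split[OF that] monomial_Cons by metis
    also have "h ^ hd as = h ^ m * h ^ (hd as - m)" using m(2)[OF that] by (simp flip: power_add)
    finally show ?thesis by (simp add: mult.assoc)
  qed
  then have "(\<Sum>as\<in>A. \<iota> (c as) * monomial (h # hs) as) = h ^ m * (\<Sum>as\<in>A. S as)"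
    unfolding sum_distrib_left S_def by (intro sum.cong) (auto simp: mult.left_commute)
  then have "h ^ m * (\<Sum>as\<in>A. S as) \<in> P k" using Cons.prems(7) by simp
  \<comment> \<open>\<open>h\<close> avoids the prime \<open>P k\<close>, so the common factor
    \<open>h ^ m\<close> can be cancelled.\<close>
  moreover have "h ^ j \<notin> P k" for j
  proof (induction j)
    case 0
    then show ?case using P(1) by (simp add: prime_in_def)
  next
    case (Suc j)
    then show ?case using P(1) h alg_power[OF h(3), of j] unfolding prime_in_def power_Suc by blast
  qed
  ultimately have "(\<Sum>as\<in>A. S as) \<in> P k"
    using P(1) alg_power[OF h(3)] alg_sum[of A S, OF SZ] unfolding prime_in_def by blast
  then have sumS: "(\<Sum>as\<in>A. S as) \<in> P (Suc k)"
    using sub k(1) by blast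
  define B where "B = {as \<in> A. hd as = m}"
  \<comment> \<open>A first exponent above \<open>m\<close> leaves a factor \<open>h\<close>, which
    lies in \<open>P (Suc k)\<close>. Modulo this prime only the terms of \<open>B\<close> remain,
    and these no longer contain \<open>h\<close>.\<close>
  have "S as \<in> P (Suc k)" if "as \<in> A - B" for as
  proof -
    have "hd as - m = Suc (hd as - m - 1)" using that m(2)[of as] by (auto simp: B_def)
    then have "S as = (\<iota> (c as) * (h ^ (hd as - m - 1) * monomial hs (tl as))) * h"
      unfolding S_def by (metis (no_types) mult.assoc mult.commute power_Suc)
    moreover have "\<iota> (c as) * (h ^ (hd as - m - 1) * monomial hs (tl as)) \<in> alg Z"
      using h(3) hsZ by (intro alg.mult alg.const alg_power)
    ultimately show ?thesis using P(2) h(1) unfolding prime_in_def by metis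
  qed
  then have rest: "(\<Sum>as\<in>A - B. S as) \<in> P (Suc k)" by (rule prime_in_sum[OF P(2)])
  have "(\<Sum>as\<in>A. S as) = (\<Sum>as\<in>A - B. S as) + (\<Sum>as\<in>B. S as)"
    using Cons.prems(3) by (subst sum.subset_diff[of B]) (auto simp: B_def)
  then have "(\<Sum>as\<in>B. S as) = (\<Sum>as\<in>A. S as) + \<iota> (- 1) * (\<Sum>as\<in>A - B. S as)"
    by (simp add: \<iota>_minus)
  then have sumB: "(\<Sum>as\<in>B. S as) \<in> P (Suc k)"
    using sumS rest P(2) alg.const[of "- 1" Z] unfolding prime_in_def by metis
  define A' where "A' = {as. m # as \<in> A}"
  have B: "B = (#) m ` A'" using split by (auto simp: B_def A'_def image_iff) metis
  have fin: "finite A'"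
    unfolding A'_def using finite_vimageI[OF Cons.prems(3), of "(#) m"]
    by (simp add: vimage_def inj_on_def)
  have "(\<Sum>as\<in>B. S as) = (\<Sum>as\<in>A'. \<iota> (c (m # as)) * monomial hs as)"
    unfolding B by (subst sum.reindex) (auto simp: S_def inj_on_def)
  with sumB have "(\<Sum>as\<in>A'. \<iota> (c (m # as)) * monomial hs as) \<in> P (Suc k)" by simp
  moreover have "A' \<noteq> {}"
  proof -
    obtain as where "as \<in> A" "hd as = m" using m(1) by auto
    with split[of as] have "tl as \<in> A'" by (simp add: A'_def)
    then show ?thesis by blast
  qed
  moreover have "length as = length hs" "c (m # as) \<noteq> 0" if "as \<in> A'" for as
    using that Cons.prems(5,6)[of "m # as"] by (auto simp: A'_def)
  ultimately show False
    using Cons.IH[of "Suc k" A' "\<lambda>as. c (m # as)"] k(3) fin Cons.prems(1) by simp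
qed

text \<open>The relation that growth provides for \<open>r + 1\<close> elements of the successive
  differences has value 0, hence lies in \<open>P 0\<close>, where
  \<open>prime_chain_relation\<close> starts.\<close>

lemma prime_chain_length_le:
  assumes "growth_le Z r" "\<And>i. i \<le> d \<Longrightarrow> prime_in (alg Z) (P i)" "\<And>i. i < d \<Longrightarrow> P i \<subset> P (Suc i)"
  shows "d \<le> r"
proof (rule ccontr)
  assume "\<not> d \<le> r"
  then have r: "Suc r \<le> d" by simp
  have "\<forall>i<d. \<exists>x. x \<in> P (Suc i) - P i" using assms(3) by blast
  then obtain x where x: "\<And>i. i < d \<Longrightarrow> x i \<in> P (Suc i) - P i" by metis
  have "x i \<in> alg Z" if "i < d" for i
    using x[OF that] assms(2)[of "Suc i"] that by (auto simp: prime_in_def)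
  then have hsZ: "set (map x [0..<Suc r]) \<subseteq> alg Z" using r by auto
  define hs where "hs = map x [0..<Suc r]"
  have hs: "set hs \<subseteq> alg Z" "length hs = Suc r" using hsZ by (simp_all add: hs_def)
  obtain A c where A: "finite A" "\<And>as. as \<in> A \<Longrightarrow> length as = length hs"
    "(\<Sum>as\<in>A. \<iota> (c as) * monomial hs as) = 0" "\<exists>as\<in>A. c as \<noteq> 0"
    using growth_le_dependent[OF assms(1) hs] by blast
  define A' where "A' = {as \<in> A. c as \<noteq> 0}"
  have "(\<Sum>as\<in>A'. \<iota> (c as) * monomial hs as) = 0"
    unfolding A(3)[symmetric] A'_def using A(1) by (intro sum.mono_neutral_left) auto
  moreover have "0 \<in> P 0" using assms(2)[of 0] by (simp add: prime_in_def)
  ultimately have "(\<Sum>as\<in>A'. \<iota> (c as) * monomial hs as) \<in> P 0" by simp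
  then show False
  proof (rule prime_chain_relation[rotated -1])
    show "prime_in (alg Z) (P i)" if "i \<le> Suc r" for i using assms(2)[of i] that r by linarith
    show "x i \<in> P (Suc i) - P i" if "i < Suc r" for i using x[of i] that r by linarith
    show "P i \<subseteq> P (Suc i)" if "i < Suc r" for i
    proof -
      have "P i \<subset> P (Suc i)" using assms(3)[of i] that r by linarith
      then show ?thesis by blast
    qed
    show "0 + length hs = Suc r" using hs(2) by simp
    show "hs = map x [0..<Suc r]" by (rule hs_def)
    show "finite A'" "A' \<noteq> {}" using A(1,4) by (auto simp: A'_def)
    show "length as = length hs" "c as \<noteq> 0" if "as \<in> A'" for as
      using that A(2) by (auto simp: A'_def)
  qed
qed

end

section \<open>Polynomial rings\<close>

abbreviation mconst :: "'f::field \<Rightarrow> ('v, 'f) mpoly" where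
  "mconst \<equiv> Poly_Mapping.single 0"

interpretation mp: field_algebra "mconst :: 'f::field \<Rightarrow> ('v::linorder, 'f) mpoly"
  by unfold_locales (simp_all add: single_add mult_single)

lemma mpoly_eq_sum_single:
  "p = (\<Sum>t\<in>Poly_Mapping.keys p. Poly_Mapping.single t (Poly_Mapping.lookup p t))"
  by (rule poly_mapping_eqI) (auto simp: lookup_sum lookup_single when_def in_keys_iff)

lemma mpoly_induct [case_names single add]:
  assumes "\<And>t c. P (Poly_Mapping.single t c)" "\<And>p q. P p \<Longrightarrow> P q \<Longrightarrow> P (p + q)"
  shows "P (p :: 'k \<Rightarrow>\<^sub>0 'c::comm_monoid_add)"
proof -
  have "P (\<Sum>t\<in>A. Poly_Mapping.single t (Poly_Mapping.lookup p t))" for A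
    by (induction A rule: infinite_finite_induct) (use assms single_zero in \<open>metis sum.infinite sum.empty sum.insert\<close>)+
  then show ?thesis using mpoly_eq_sum_single[of p] by metis
qed

lemma partial_deriv_add: "partial_deriv v (p + q) = partial_deriv v p + partial_deriv v q"
  unfolding partial_deriv_def
  by (rule setsum_keys_plus_distrib) (simp_all add: ring_distribs single_add)

lemma partial_deriv_single:
  "partial_deriv v (Poly_Mapping.single t c) =
     Poly_Mapping.single (t - Poly_Mapping.single v 1) (of_nat (Poly_Mapping.lookup t v) * c)"
  by (auto simp: partial_deriv_def)

lemma partial_deriv_mult:
  "partial_deriv v (p * q) = p * partial_deriv v q + q * partial_deriv v p"
proof (induction p rule: mpoly_induct)
  case (single s c)
  show ?case
  proof (induction q rule: mpoly_induct)
    case (single t d)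
    let ?e = "Poly_Mapping.single v (1::nat)"
    \<comment> \<open>If \<open>v\<close> does not occur in \<open>t\<close> the exponents can
      differ, but then both sides of fact \<open>1\<close> have coefficient 0.\<close>
    have e: "s + (t - ?e) = s + t - ?e" if "Poly_Mapping.lookup t v \<noteq> 0" for s t
      by (rule poly_mapping_eqI) (use that in \<open>auto simp: lookup_add lookup_minus lookup_single when_def\<close>)
    have 1: "Poly_Mapping.single s c * Poly_Mapping.single (t - ?e) (of_nat (Poly_Mapping.lookup t v) * d)
      = Poly_Mapping.single (s + t - ?e) (of_nat (Poly_Mapping.lookup t v) * (c * d))" for s t and c d :: 'b
      by (cases "Poly_Mapping.lookup t v = 0") (simp_all add: mult_single e[simplified] mult.left_commute)
    have "partial_deriv v (Poly_Mapping.single s c * Poly_Mapping.single t d)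
      = Poly_Mapping.single (s + t - ?e) (of_nat (Poly_Mapping.lookup (s + t) v) * (c * d))"
      by (simp only: mult_single partial_deriv_single)
    also have "\<dots> = Poly_Mapping.single (s + t - ?e) (of_nat (Poly_Mapping.lookup t v) * (c * d))
      + Poly_Mapping.single (t + s - ?e) (of_nat (Poly_Mapping.lookup s v) * (d * c))"
      by (simp add: lookup_add algebra_simps flip: single_add)
    also have "\<dots> = Poly_Mapping.single s c * partial_deriv v (Poly_Mapping.single t d)
      + Poly_Mapping.single t d * partial_deriv v (Poly_Mapping.single s c)"
      by (simp only: partial_deriv_single 1)
    finally show ?case .
  next
    case (add p q)
    then show ?case by (simp add: ring_distribs partial_deriv_add)
  qed
next
  case (add p q)
  then show ?case by (simp add: ring_distribs partial_deriv_add)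
qed

lemma partial_deriv_const: "partial_deriv v (mconst c) = 0"
  by (simp add: partial_deriv_single)

lemma partial_deriv_var: "partial_deriv v (var w) = (if v = w then 1 else 0)"
  by (auto simp: var_def partial_deriv_single lookup_single when_def)

section \<open>Substitution for the variables\<close>

definition subst :: "('v::finite \<Rightarrow> ('v, 'f::field) mpoly) \<Rightarrow> ('v, 'f) mpoly \<Rightarrow> ('v, 'f) mpoly" where
  "subst \<sigma> p = (\<Sum>t\<in>Poly_Mapping.keys p. mconst (Poly_Mapping.lookup p t) * (\<Prod>v\<in>UNIV. \<sigma> v ^ Poly_Mapping.lookup t v))"

lemma subst_add: "subst \<sigma> (p + q) = subst \<sigma> p + subst \<sigma> q"
  unfolding subst_def
  by (rule setsum_keys_plus_distrib) (simp_all add: ring_distribs single_add)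

lemma subst_single:
  "subst \<sigma> (Poly_Mapping.single t c) = mconst c * (\<Prod>v\<in>UNIV. \<sigma> v ^ Poly_Mapping.lookup t v)"
  by (auto simp: subst_def)

lemma subst_mult: "subst \<sigma> (p * q) = subst \<sigma> p * subst \<sigma> q"
proof (induction p rule: mpoly_induct)
  case (single s c)
  show ?case
  proof (induction q rule: mpoly_induct)
    case (single t d)
    have "mconst (c * d) = (mconst c * mconst d :: ('a, 'b) mpoly)" by (simp add: mult_single)
    then show ?case
      by (simp only: mult_single[of s c t d] subst_single lookup_add power_add prod.distrib mult_ac)
  qed (simp add: ring_distribs subst_add)
qed (simp add: ring_distribs subst_add)

lemma subst_var: "subst \<sigma> (var v) = \<sigma> v"
proof -
  have "(\<Prod>w\<in>UNIV. \<sigma> w ^ Poly_Mapping.lookup (Poly_Mapping.single v 1) w) = (\<Prod>w\<in>{v}. \<sigma> w)"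
    by (rule prod.mono_neutral_cong_right) (auto simp: lookup_single when_def)
  then show ?thesis by (simp add: var_def subst_single)
qed

lemma alg_hom_subst: "mp.alg_hom (subst \<sigma> :: ('v::{finite, linorder}, 'f::field) mpoly \<Rightarrow> _)"
  by (simp add: mp.alg_hom_def subst_add subst_mult) (simp add: subst_single)

lemma var_power: "var v ^ k = Poly_Mapping.single (Poly_Mapping.single v k) 1"
  by (induction k) (auto simp: var_def mult_single simp flip: single_add)

lemma inj_var_power: "inj (\<lambda>k. var v ^ k :: ('v, 'f::field) mpoly)"
proof (rule injI)
  fix j k assume "var v ^ j = (var v ^ k :: ('v, 'f) mpoly)"
  then have "Poly_Mapping.single (Poly_Mapping.single v j) (1::'f) = Poly_Mapping.single (Poly_Mapping.single v k) 1"
    by (simp only: var_power)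
  then have "Poly_Mapping.single v j = Poly_Mapping.single v k"
    by (metis keys_single one_neq_zero singleton_inject)
  then show "j = k" by (metis lookup_single_eq)
qed

lemma inj_var: "inj (var :: 'v \<Rightarrow> ('v, 'f::field) mpoly)"
proof (rule injI)
  fix v w :: 'v assume "var v = (var w :: ('v, 'f) mpoly)"
  then have "Poly_Mapping.single v (1::nat) = Poly_Mapping.single w 1"
    unfolding var_def by (metis keys_single one_neq_zero singleton_inject)
  then show "v = w" by (metis keys_single one_neq_zero singleton_inject)
qed

lemma single_eq_prod_var:
  "Poly_Mapping.single t (1::'f::field) = (\<Prod>v\<in>UNIV. var v ^ Poly_Mapping.lookup (t :: 'v::finite \<Rightarrow>\<^sub>0 nat) v)"
proof -
  have "(\<Prod>v\<in>A. Poly_Mapping.single (f v) (1::'f)) = Poly_Mapping.single (\<Sum>v\<in>A. f v) 1"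
    for A :: "'v set" and f :: "'v \<Rightarrow> 'v \<Rightarrow>\<^sub>0 nat"
    by (induction A rule: infinite_finite_induct) (auto simp: mult_single)
  moreover have "(\<Sum>v\<in>UNIV. Poly_Mapping.single v (Poly_Mapping.lookup t v)) = t"
    by (rule poly_mapping_eqI) (simp add: lookup_sum lookup_single when_def)
  ultimately show ?thesis unfolding var_power by simp
qed

lemma alg_range_var: "p \<in> mp.alg (range var)" for p :: "('v::{finite, linorder}, 'f::field) mpoly"
proof (induction p rule: mpoly_induct)
  case (single t c)
  have "mconst c * (\<Prod>v\<in>A. var v ^ Poly_Mapping.lookup t v) \<in> mp.alg (range var)" for A
  proof (rule mp.alg.mult[OF mp.alg.const])
    show "(\<Prod>v\<in>A. var v ^ Poly_Mapping.lookup t v) \<in> mp.alg (range (var :: 'v \<Rightarrow> ('v, 'f) mpoly))"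
      by (induction A rule: infinite_finite_induct)
        (auto intro!: mp.alg.mult mp.alg_power intro: mp.alg.gen)
  qed
  from this[of UNIV] show ?case
    unfolding single_eq_prod_var[symmetric] by (simp add: mult_single)
qed (rule mp.alg.add)

lemma subst_variable:
  fixes x :: "('v::{finite, linorder}, 'f::field) mpoly"
  assumes "x \<in> range var"
  shows "\<exists>\<psi>. mp.alg_hom \<psi> \<and> \<psi> x = a \<and> (\<forall>y\<in>range var - {x}. \<psi> y = y)"
proof -
  obtain v where v: "x = var v" using assms by blast
  have "subst (var(v := a)) y = y" if "y \<in> range var - {x}" for y
    using that v by (auto simp: subst_var)
  then show ?thesis using v
    by (intro exI[of _ "subst (var(v := a))"]) (auto simp: alg_hom_subst subst_var)
qed

text \<open>Substituting any \<open>a\<close> for \<open>x\<close> fixes the coefficients of a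
  relation of \<open>x\<close> over the other variables, so every \<open>a\<close> would be a root;
  the powers of \<open>x\<close> are infinitely many, also over a finite field.\<close>

lemma indep_vars:
  fixes xs :: "('v::{finite, linorder}, 'f::field) mpoly list"
  assumes "distinct xs" "set xs \<subseteq> range var"
  shows "mp.indep {} xs"
  using assms
proof (induction xs)
  case (Cons x xs)
  obtain v where v: "x = var v" using Cons.prems by auto
  have "\<not> mp.algebraic_over (mp.alg (set xs)) x"
  proof
    assume "mp.algebraic_over (mp.alg (set xs)) x"
    then obtain p where p: "p \<noteq> 0" "\<And>i. Polynomial.coeff p i \<in> mp.alg (set xs)" "poly p x = 0"
      by (auto simp: mp.algebraic_over_def)
    have "poly p a = 0" for a
    proof -
      obtain \<psi> where \<psi>: "mp.alg_hom \<psi>" "\<psi> x = a" "\<forall>y\<in>range var - {x}. \<psi> y = y"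
        using subst_variable Cons.prems(2) by (metis insert_subset list.simps(15))
      have fx: "\<psi> y = y" if "y \<in> set xs" for y
        using \<psi>(3) that Cons.prems by auto
      have "map_poly \<psi> p = p"
        using p(2) mp.alg_hom_fixes[OF \<psi>(1) fx]
        by (intro poly_eqI) (auto simp: coeff_map_poly mp.alg_hom_0[OF \<psi>(1)])
      then show ?thesis
        using mp.alg_hom_poly[OF \<psi>(1), of p x] p(3) \<psi>(2) mp.alg_hom_0[OF \<psi>(1)] by simp
    qed
    moreover have "infinite (range (\<lambda>k. x ^ k))"
      unfolding v using finite_imageD[OF _ inj_var_power] infinite_UNIV_nat by metis
    ultimately show False
      using poly_roots_finite[OF p(1)] by (metis (mono_tags, lifting) finite_subset mem_Collect_eq subsetI)
  qed
  with Cons show ?case by simp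
qed simp

section \<open>Total degree and sets of admissible degrees\<close>

definition tdeg :: "('v::finite \<Rightarrow>\<^sub>0 nat) \<Rightarrow> nat" where
  "tdeg t = (\<Sum>v\<in>UNIV. Poly_Mapping.lookup t v)"

lemma tdeg_0 [simp]: "tdeg 0 = 0"
  by (simp add: tdeg_def)

lemma tdeg_add: "tdeg (s + t) = tdeg s + tdeg t"
  by (simp add: tdeg_def lookup_add sum.distrib)

lemma tdeg_single [simp]: "tdeg (Poly_Mapping.single v k) = k"
  by (simp add: tdeg_def lookup_single when_def)

text \<open>A set of degrees covers three uses: \<open>{d}\<close> for forms of degree
  \<open>d\<close>, \<open>{..D}\<close> for degree at most \<open>D\<close>, and
  \<open>{d..}\<close> for order at least \<open>d\<close>.\<close>

definition degs_in :: "nat set \<Rightarrow> ('v::finite, 'f::field) mpoly set" where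
  "degs_in A = {p. \<forall>t\<in>Poly_Mapping.keys p. tdeg t \<in> A}"

lemma degs_in_0 [simp]: "0 \<in> degs_in A"
  by (simp add: degs_in_def)

lemma degs_in_add: "p \<in> degs_in A \<Longrightarrow> q \<in> degs_in A \<Longrightarrow> p + q \<in> degs_in A"
  using keys_add[of p q] by (auto simp: degs_in_def)

lemma degs_in_diff: "p \<in> degs_in A \<Longrightarrow> q \<in> degs_in A \<Longrightarrow> p - q \<in> degs_in A"
  using keys_diff[of p q] by (auto simp: degs_in_def)

lemma degs_in_mono: "A \<subseteq> B \<Longrightarrow> degs_in A \<subseteq> degs_in B"
  by (auto simp: degs_in_def)

lemma degs_in_mult:
  assumes "p \<in> degs_in A" "q \<in> degs_in B" "\<And>a b. a \<in> A \<Longrightarrow> b \<in> B \<Longrightarrow> a + b \<in> C"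
  shows "p * q \<in> degs_in C"
  using keys_mult[of p q] assms by (auto simp: degs_in_def tdeg_add)

lemma degs_in_mconst: "0 \<in> A \<Longrightarrow> mconst c \<in> degs_in A"
  by (auto simp: degs_in_def)

lemma degs_in_one: "0 \<in> A \<Longrightarrow> 1 \<in> degs_in A"
  using degs_in_mconst[of A 1] by simp

lemma degs_in_var: "1 \<in> A \<Longrightarrow> var v \<in> degs_in A"
  by (auto simp: degs_in_def var_def)

lemma degs_in_scale: "p \<in> degs_in A \<Longrightarrow> mconst c * p \<in> degs_in A"
  by (rule degs_in_mult[OF degs_in_mconst[of "{0}"]]) auto

lemma degs_in_span: "B \<subseteq> degs_in A \<Longrightarrow> p \<in> mp.V.span B \<Longrightarrow> p \<in> degs_in A"
  for p :: "('v::{finite,linorder}, 'f::field) mpoly"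
proof -
  assume B: "B \<subseteq> degs_in A" and "p \<in> mp.V.span B"
  from this(2) show "p \<in> degs_in A"
    by (induction rule: mp.V.span_induct_alt) (use B in \<open>auto intro: degs_in_add degs_in_scale\<close>)
qed

lemma binomial_gen_degs: "binomial_gen e e' \<in> degs_in {2}"
  unfolding binomial_gen_def Let_def
  by (intro degs_in_diff degs_in_mult[of _ "{1}" _ "{1}"] degs_in_var) auto

section \<open>Degree bounds for algebraic relations\<close>

text \<open>The weights are degree bounds of the polynomials to be multiplied, so these exponents
  index the products whose resulting bound is at most \<open>D\<close>; with all weights 1 they
  index ordinary monomials.\<close>

definition weighted_exponents :: "nat list \<Rightarrow> nat \<Rightarrow> nat list set" where
  "weighted_exponents ws D = {as. length as = length ws \<and> sum_list (map2 (*) ws as) \<le> D}"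

lemma weighted_exponents_subset:
  assumes "\<And>w. w \<in> set ws \<Longrightarrow> w \<ge> 1"
  shows "weighted_exponents ws D \<subseteq> {as. set as \<subseteq> {..D} \<and> length as = length ws}"
proof -
  have "set as \<subseteq> {..sum_list (map2 (*) ws as)}" if "length as = length ws" for as
    using that[symmetric] assms
  proof (induction ws as rule: list_induct2)
    case (Cons w ws a as)
    then have "a \<le> w * a" by simp
    then show ?case using Cons by (auto intro: trans_le_add1 trans_le_add2)
  qed simp
  then show ?thesis unfolding weighted_exponents_def by fastforce
qed

lemma finite_weighted_exponents: "(\<And>w. w \<in> set ws \<Longrightarrow> w \<ge> 1) \<Longrightarrow> finite (weighted_exponents ws D)"
  by (rule finite_subset[OF weighted_exponents_subset]) (auto simp: finite_lists_length_eq)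

lemma card_weighted_exponents_le: "(\<And>w. w \<in> set ws \<Longrightarrow> w \<ge> 1) \<Longrightarrow> card (weighted_exponents ws D) \<le> (D + 1) ^ length ws"
  using card_mono[OF _ weighted_exponents_subset[of ws D]] card_lists_length_eq[of "{..D}" "length ws"]
    finite_lists_length_eq[of "{..D}" "length ws"] by simp

lemma sum_list_map2_replicate_1:
  "sum_list (map2 (*) (replicate (length as) 1) as) = sum_list (as :: nat list)"
  by (induction as) auto

lemma weighted_exponents_replicate_1: "weighted_exponents (replicate n 1) D = {as. length as = n \<and> sum_list as \<le> D}"
  unfolding weighted_exponents_def length_replicate using sum_list_map2_replicate_1 by metis

lemma finite_card_listset_lessThan:
  "finite (listset (map lessThan ws)) \<and> card (listset (map lessThan ws)) = prod_list (ws :: nat list)"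
proof (induction ws)
  case (Cons w ws)
  have eq: "listset (map lessThan (w # ws)) = (\<lambda>(a, b). a # b) ` ({..<w} \<times> listset (map lessThan ws))"
    by (auto simp: set_Cons_def)
  have "inj_on (\<lambda>(a, b). a # b) ({..<w} \<times> listset (map lessThan ws))" by (auto simp: inj_on_def)
  then have "card (listset (map lessThan (w # ws))) = w * card (listset (map lessThan ws))"
    unfolding eq by (simp add: card_image card_cartesian_product)
  moreover have "finite (listset (map lessThan (w # ws)))" unfolding eq using Cons by auto
  ultimately show ?case using Cons by simp
qed simp

text \<open>An exponent vector is determined by its quotients and remainders modulo the weights.\<close>

lemma card_weighted_exponents_replicate_1_le:
  assumes "\<And>w. w \<in> set ws \<Longrightarrow> w \<ge> 1"
  shows "card (weighted_exponents (replicate (length ws) 1) D) \<le> prod_list ws * card (weighted_exponents ws D)"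
proof -
  define F where "F as = (map2 (mod) as ws, map2 (div) as ws)" for as :: "nat list"
  have 1: "map2 (mod) as ws \<in> listset (map lessThan ws) \<and>
      sum_list (map2 (*) ws (map2 (div) as ws)) \<le> sum_list as"
    if "length as = length ws" for as
    using that assms
  proof (induction as ws rule: list_induct2)
    case (Cons a as w ws)
    have "w * (a div w) \<le> a" by (simp add: times_div_less_eq_dividend)
    moreover have "a mod w < w" using Cons.prems[of w] by simp
    ultimately show ?case using Cons by (auto simp: set_Cons_def intro!: add_mono)
  qed simp
  have 2: "as = bs" if "length as = length ws" "length bs = length ws" "F as = F bs" for as bs
  proof (rule nth_equalityI)
    fix i assume i: "i < length as"
    have "map2 (mod) as ws ! i = map2 (mod) bs ws ! i" "map2 (div) as ws ! i = map2 (div) bs ws ! i"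
      using that(3) by (simp_all add: F_def)
    then show "as ! i = bs ! i" using i that(1,2) by (simp) (metis div_mult_mod_eq)
  qed (use that in simp)
  have "card (weighted_exponents (replicate (length ws) 1) D) \<le> card (listset (map lessThan ws) \<times> weighted_exponents ws D)"
  proof (rule card_inj_on_le)
    show "inj_on F (weighted_exponents (replicate (length ws) 1) D)"
      using 2 by (auto simp: inj_on_def weighted_exponents_def)
    show "F ` weighted_exponents (replicate (length ws) 1) D \<subseteq> listset (map lessThan ws) \<times> weighted_exponents ws D"
      unfolding weighted_exponents_replicate_1 using 1 by (force simp: F_def weighted_exponents_def intro: order.trans)
    show "finite (listset (map lessThan ws) \<times> weighted_exponents ws D)"
      using finite_weighted_exponents[OF assms] finite_card_listset_lessThan by auto
  qed
  then show ?thesis by (simp add: card_cartesian_product finite_card_listset_lessThan)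
qed

text \<open>Polynomial growth is slower than exponential growth with ratio \<open>1 + 1 / K\<close>.\<close>

lemma weighted_exponents_ratio:
  assumes "K \<ge> 1"
  shows "\<exists>D. K * card (weighted_exponents (replicate n 1) (D + e)) < (K + 1) * card (weighted_exponents (replicate n 1) D)"
proof (rule ccontr)
  define S where "S D = card (weighted_exponents (replicate n 1) D)" for D
  assume "\<not> ?thesis"
  then have step: "(K + 1) * S D \<le> K * S (D + e)" for D by (auto simp: S_def not_less)
  have S0: "S 0 \<ge> 1"
  proof -
    have "replicate n 0 \<in> weighted_exponents (replicate n 1) 0" unfolding weighted_exponents_replicate_1 by (simp add: sum_list_replicate)
    moreover have "finite (weighted_exponents (replicate n 1) 0)" by (rule finite_weighted_exponents) auto
    ultimately have "S 0 \<noteq> 0" unfolding S_def by (auto simp: card_eq_0_iff)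
    then show ?thesis by simp
  qed
  \<comment> \<open>Iterating the negated claim along the multiples of \<open>e\<close> gives
    exponential growth, whereas \<open>S\<close> is bounded by a polynomial.\<close>
  have ind: "(K + 1) ^ j * S 0 \<le> K ^ j * S (j * e)" for j
  proof (induction j)
    case (Suc j)
    have "(K + 1) ^ Suc j * S 0 \<le> (K + 1) * (K ^ j * S (j * e))"
      using mult_left_mono[OF Suc, of "K + 1"] by (simp only: power_Suc mult.assoc)
    also have "\<dots> \<le> K ^ j * (K * S (j * e + e))" using mult_left_mono[OF step[of "j * e"], of "K ^ j"] by (simp only: ac_simps)
    also have "\<dots> = K ^ Suc j * S (Suc j * e)" by (simp add: ac_simps)
    finally show ?case .
  qed simp
  have S_le: "S D \<le> (D + 1) ^ n" for D
    using card_weighted_exponents_le[of "replicate n 1" D] by (simp add: S_def)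
  have bound: "(K + 1) ^ j \<le> K ^ j * (j * e + 1) ^ n" for j
  proof -
    have "(K + 1) ^ j \<le> (K + 1) ^ j * S 0" using S0 by simp
    also have "\<dots> \<le> K ^ j * S (j * e)" by (rule ind)
    also have "\<dots> \<le> K ^ j * (j * e + 1) ^ n" by (intro mult_left_mono S_le) simp
    finally show ?thesis .
  qed
  define x where "x = 1 + 1 / real K"
  have x: "x > 1" using assms by (simp add: x_def)
  have xj: "x ^ j \<le> (real (j * e + 1)) ^ n" for j
  proof -
    have "real K ^ j * x ^ j = (real K + 1) ^ j"
      using assms by (simp add: x_def field_simps flip: power_mult_distrib)
    also have "\<dots> \<le> real K ^ j * real (j * e + 1) ^ n"
      using bound[of j] by (metis (mono_tags, opaque_lifting) of_nat_1 of_nat_add of_nat_le_iff of_nat_mult of_nat_power)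
    finally show ?thesis using assms by simp
  qed
  have ub: "x ^ j \<le> (real (e + 1) * real j) ^ n" if "j \<ge> 1" for j
    by (rule order.trans[OF xj power_mono]) (use that in \<open>auto simp: algebra_simps\<close>)
  \<comment> \<open>Turns \<open>(real (e + 1) * real j) ^ n\<close> into
    \<open>c * (real j * ln x) ^ n\<close>, so that the limit of \<open>y ^ n / exp y\<close>
    decides.\<close>
  define c where "c = (real (e + 1) / ln x) ^ n"
  have "((\<lambda>y::real. y ^ n / exp y) \<longlongrightarrow> 0) at_top" by (rule tendsto_power_div_exp_0)
  moreover have "filterlim (\<lambda>j. real j * ln x) at_top sequentially"
    using x by (intro filterlim_at_top_mult_tendsto_pos[OF tendsto_const _ filterlim_real_sequentially, THEN filterlim_cong[THEN iffD1, rotated -1]]) (auto simp: mult.commute)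
  ultimately have "(\<lambda>j. c * ((real j * ln x) ^ n / exp (real j * ln x))) \<longlonglongrightarrow> c * 0"
    by (intro tendsto_mult tendsto_const) (rule filterlim_compose)
  then have "\<forall>\<^sub>F j in sequentially. c * ((real j * ln x) ^ n / exp (real j * ln x)) < 1"
    by (auto dest: order_tendstoD(2)[where a = 1])
  then obtain j where j: "j \<ge> 1" "c * ((real j * ln x) ^ n / exp (real j * ln x)) < 1"
    unfolding eventually_sequentially by (metis max.cobounded1 max.cobounded2)
  have "exp (real j * ln x) = x ^ j" using x by (simp add: exp_of_nat_mult)
  moreover have "c * (real j * ln x) ^ n = (real (e + 1) * real j) ^ n"
    using x by (simp add: c_def flip: power_mult_distrib)
  moreover have "c * (real j * ln x) ^ n < x ^ j" if "exp (real j * ln x) = x ^ j"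
    using j(2) x unfolding that times_divide_eq_right by (simp add: divide_less_eq)
  ultimately have "(real (e + 1) * real j) ^ n < x ^ j" by simp
  with ub[OF j(1)] show False by simp
qed

lemma monomial_degs_in:
  fixes zs :: "('v::{finite, linorder}, 'f::field) mpoly list"
  assumes "list_all2 (\<lambda>w z. z \<in> degs_in {..w}) ws zs" "length as = length ws"
  shows "mp.monomial zs as \<in> degs_in {..sum_list (map2 (*) ws as)}"
  using assms
proof (induction ws zs arbitrary: as rule: list_all2_induct)
  case Nil
  then show ?case by (auto intro: degs_in_one)
next
  case (Cons w ws z zs)
  then obtain b bs where as: "as = b # bs" by (cases as) auto
  have "z ^ k \<in> degs_in {..w * k}" for k
    by (induction k) (auto intro: degs_in_one degs_in_mult[OF Cons.hyps(1)])
  from degs_in_mult[OF this[of b] Cons.IH[of bs], of "{..w * b + sum_list (map2 (*) ws bs)}"]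
  show ?case using Cons.prems as by simp
qed

lemma degs_in_atMost_span:
  "p \<in> degs_in {..D} \<Longrightarrow> p \<in> mp.V.span ((\<lambda>t. Poly_Mapping.single t 1) ` {t. tdeg t \<le> D})"
  for p :: "('v::{finite, linorder}, 'f::field) mpoly"
proof -
  assume p: "p \<in> degs_in {..D}"
  have "(\<Sum>t\<in>Poly_Mapping.keys p. mconst (Poly_Mapping.lookup p t) * Poly_Mapping.single t 1)
     \<in> mp.V.span ((\<lambda>t. Poly_Mapping.single t 1) ` {t. tdeg t \<le> D})"
    using p by (intro mp.V.span_sum mp.V.span_scale mp.V.span_base) (auto simp: degs_in_def)
  then show ?thesis using mpoly_eq_sum_single[of p] by (simp add: mult_single)
qed

lemma finite_card_tdeg_le:
  "finite {t :: 'v::finite \<Rightarrow>\<^sub>0 nat. tdeg t \<le> D} \<and>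
   card {t :: 'v \<Rightarrow>\<^sub>0 nat. tdeg t \<le> D} \<le> card (weighted_exponents (replicate CARD('v) 1) D)"
proof -
  obtain vs :: "'v list" where vs: "set vs = UNIV" "distinct vs"
    using finite_distinct_list[of "UNIV :: 'v set"] by auto
  have len: "length vs = CARD('v)" using distinct_card[OF vs(2)] vs(1) by simp
  define F where "F t = map (Poly_Mapping.lookup t) vs" for t :: "'v \<Rightarrow>\<^sub>0 nat"
  have F: "inj_on F {t. tdeg t \<le> D}"
  proof (rule inj_onI)
    fix s t assume "F s = F t"
    then have "Poly_Mapping.lookup s v = Poly_Mapping.lookup t v" for v using vs(1) by (auto simp: F_def)
    then show "s = t" by (rule poly_mapping_eqI)
  qed
  have "sum_list (F t) = tdeg t" for t
    using vs by (simp add: F_def tdeg_def sum_list_distinct_conv_sum_set)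
  then have sub: "F ` {t. tdeg t \<le> D} \<subseteq> weighted_exponents (replicate CARD('v) 1) D"
    unfolding weighted_exponents_replicate_1 by (auto simp: F_def len)
  have fin: "finite (weighted_exponents (replicate CARD('v) 1) D)" by (rule finite_weighted_exponents) auto
  show ?thesis using card_inj_on_le[OF F sub fin] finite_imageD[OF finite_subset[OF sub fin] F] by auto
qed

text \<open>
  Up to weighted degree \<open>D\<close> there are at least $(K + 1)/K$ times as many monomials in the
  generators and \<open>h\<close>, of degree at most \<open>K\<close> in \<open>h\<close>, as monomials in the variables; hence
  they are linearly dependent for large \<open>D\<close>, where \<open>K\<close> is the product of the weights. The
  independence of \<open>ys\<close> over \<open>h\<close> and \<open>ts\<close> allows
  splitting the resulting relation into relations over \<open>ts\<close> alone.
\<close>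

lemma relation_degree_bound:
  fixes ts ys :: "('v::{finite, linorder}, 'f::field) mpoly list"
  assumes ts: "mp.indep {} ts" and ys: "mp.indep (insert h (set ts)) ys"
    and len: "length (ys @ ts) = CARD('v)"
    and deg: "list_all2 (\<lambda>w z. z \<in> degs_in {..w}) ws (ys @ ts)" and ws: "\<And>w. w \<in> set ws \<Longrightarrow> w \<ge> 1"
    and h: "h \<in> degs_in {..e}"
  shows "\<exists>p. p \<noteq> 0 \<and> (\<forall>i. Polynomial.coeff p i \<in> mp.alg (set ts)) \<and>
    Polynomial.degree p \<le> prod_list ws \<and> poly p h = 0"
proof -
  define K where "K = prod_list ws"
  define N where "N = CARD('v)"
  have lenws: "length ws = N" using list_all2_lengthD[OF deg] len by (simp add: N_def)
  have "K \<noteq> 0" using ws unfolding K_def prod_list_zero_iff by force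
  then have K: "K \<ge> 1" by simp
  obtain D where D: "K * card (weighted_exponents (replicate N 1) (D + K * e)) < (K + 1) * card (weighted_exponents (replicate N 1) D)"
    using weighted_exponents_ratio[OF K] by blast
  define E where "E = weighted_exponents ws D"
  have finE: "finite E" unfolding E_def by (rule finite_weighted_exponents[OF ws])
  \<comment> \<open>\<open>K + 1\<close> powers of \<open>h\<close>: one more than the factor
    \<open>K\<close> lost in comparing weighted with ordinary degree.\<close>
  define A where "A = E \<times> {..K}"
  define f where "f = (\<lambda>(as, k). mp.monomial (ys @ ts) as * h ^ k)"
  define U where "U = (\<lambda>t. Poly_Mapping.single t (1::'f)) ` {t :: 'v \<Rightarrow>\<^sub>0 nat. tdeg t \<le> D + K * e}"
  have finU: "finite U" unfolding U_def using finite_card_tdeg_le by blast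
  have "card U \<le> card {t :: 'v \<Rightarrow>\<^sub>0 nat. tdeg t \<le> D + K * e}"
    unfolding U_def using finite_card_tdeg_le by (intro card_image_le) blast
  also have "\<dots> \<le> card (weighted_exponents (replicate N 1) (D + K * e))"
    unfolding N_def using finite_card_tdeg_le by blast
  \<comment> \<open>Multiplying by \<open>K\<close> expresses the ratio \<open>(K + 1) / K\<close>
    within the natural numbers.\<close>
  finally have "K * card U \<le> K * card (weighted_exponents (replicate N 1) (D + K * e))" by simp
  also have "\<dots> < (K + 1) * card (weighted_exponents (replicate N 1) D)" by (rule D)
  also have "\<dots> \<le> (K + 1) * (K * card E)"
    using card_weighted_exponents_replicate_1_le[of ws D] ws unfolding lenws E_def K_def by (intro mult_left_mono) auto
  also have "\<dots> = K * card A" by (simp add: A_def card_cartesian_product algebra_simps)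
  finally have cardU: "card U < card A" by simp
  have hk: "h ^ k \<in> degs_in {..e * k}" for k
    by (induction k) (auto intro: degs_in_one degs_in_mult[OF h])
  have finA: "finite A" using finE by (simp add: A_def)
  have f_span: "f a \<in> mp.V.span U" if a: "a \<in> A" for a
  proof -
    obtain as k where ak: "a = (as, k)" "as \<in> E" "k \<le> K" using a by (auto simp: A_def)
    then have as: "length as = length ws" "sum_list (map2 (*) ws as) \<le> D" by (auto simp: E_def weighted_exponents_def)
    have ek: "e * k \<le> K * e" using ak(3) by simp
    have "f a \<in> degs_in {..D + K * e}"
      unfolding f_def ak(1) prod.case
    proof (rule degs_in_mult[OF monomial_degs_in[OF deg as(1)] hk])
      fix a b assume "a \<in> {..sum_list (map2 (*) ws as)}" "b \<in> {..e * k}"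
      then have "a \<le> D" "b \<le> K * e" using as(2) order.trans[OF _ ek] by auto
      then show "a + b \<in> {..D + K * e}" by simp
    qed
    then show ?thesis unfolding U_def by (rule degs_in_atMost_span)
  qed
  obtain c where c: "(\<Sum>a\<in>A. mconst (c a) * f a) = 0" "\<exists>a\<in>A. c a \<noteq> 0"
    using mp.dependent_family[OF finA finU cardU, of f] f_span by blast
  then obtain as0 k0 where 0: "(as0, k0) \<in> A" "c (as0, k0) \<noteq> 0" by auto
  define n where "n = length ys"
  have lenA: "length as = length ys + length ts" if "(as, k) \<in> A" for as k
    using that len lenws by (simp add: A_def E_def weighted_exponents_def N_def)
  \<comment> \<open>Terms are grouped by their exponents in \<open>ys\<close>; each group sum
    \<open>d \<beta>\<close> is a polynomial in \<open>ts\<close> and \<open>h\<close>.\<close>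
  define Ab where "Ab \<beta> = {a \<in> A. take n (fst a) = \<beta>}" for \<beta>
  define g where "g a = mconst (c a) * (mp.monomial ts (drop n (fst a)) * h ^ snd a)" for a
  define d where "d \<beta> = (\<Sum>a\<in>Ab \<beta>. g a)" for \<beta>
  define B where "B = (\<lambda>a. take n (fst a)) ` A"
  have "mconst (c a) * f a = g a * mp.monomial ys (take n (fst a))" if a: "a \<in> A" for a
  proof -
    obtain as k where ak: "a = (as, k)" by (cases a)
    have "length (take n as) = length ys" using lenA a ak by (simp add: n_def)
    then have "mp.monomial (ys @ ts) (take n as @ drop n as)
      = mp.monomial ys (take n as) * mp.monomial ts (drop n as)" by (rule mp.monomial_append)
    then show ?thesis by (simp add: f_def g_def ak mult_ac)
  qed
  then have "0 = (\<Sum>a\<in>A. g a * mp.monomial ys (take n (fst a)))" using c(1) by simp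
  also have "\<dots> = (\<Sum>\<beta>\<in>B. \<Sum>a\<in>Ab \<beta>. g a * mp.monomial ys (take n (fst a)))"
    unfolding B_def Ab_def using finA by (rule sum.image_gen)
  also have "\<dots> = (\<Sum>\<beta>\<in>B. d \<beta> * mp.monomial ys \<beta>)"
    unfolding d_def sum_distrib_right by (intro sum.cong) (auto simp: Ab_def)
  finally have rel: "(\<Sum>\<beta>\<in>B. d \<beta> * mp.monomial ys \<beta>) = 0" by simp
  have ts_in: "mp.monomial ts as \<in> mp.alg (set ts)" for as
    by (rule mp.monomial_in_alg) (auto intro: mp.alg.gen)
  then have ts_in': "mp.monomial ts as \<in> mp.alg (insert h (set ts))" for as
    using mp.alg_mono[of "set ts" "insert h (set ts)"] by auto
  \<comment> \<open>The group of a term with nonzero coefficient: its sum is the relation sought,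
    and independence of \<open>ts\<close> will show that it is not the zero polynomial in
    \<open>h\<close>.\<close>
  define \<beta> where "\<beta> = take n as0"
  have "d \<beta> = 0"
  proof (rule mp.indep_monomials[OF ys _ _ _ rel])
    show "d \<beta> \<in> mp.alg (insert h (set ts))" for \<beta>
      unfolding d_def g_def
      by (intro mp.alg_sum mp.alg.mult mp.alg.const mp.alg_power ts_in') (auto intro: mp.alg.gen)
    show "\<beta> \<in> B" using 0 by (force simp: B_def \<beta>_def)
  qed (use finA lenA in \<open>auto simp: B_def n_def\<close>)
  define p where
    "p = (\<Sum>a\<in>Ab \<beta>. Polynomial.monom (mconst (c a) * mp.monomial ts (drop n (fst a))) (snd a))"
  have coeffp: "Polynomial.coeff p i =
    (\<Sum>a\<in>{a \<in> Ab \<beta>. snd a = i}. mconst (c a) * mp.monomial ts (drop n (fst a)))" for i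
    unfolding p_def coeff_sum coeff_monom using finA by (subst sum.inter_filter) (auto simp: Ab_def)
  have "poly p h = d \<beta>"
    by (simp add: p_def d_def g_def poly_sum poly_monom mult_ac)
  moreover have "Polynomial.coeff p i \<in> mp.alg (set ts)" for i
    unfolding coeffp by (intro mp.alg_sum mp.alg.mult mp.alg.const ts_in)
  moreover have "Polynomial.degree p \<le> K"
  proof (rule degree_le, intro allI impI)
    fix i assume "K < i"
    then have "{a \<in> Ab \<beta>. snd a = i} = {}" by (auto simp: Ab_def A_def)
    then show "Polynomial.coeff p i = 0" unfolding coeffp by (simp only: sum.empty)
  qed
  moreover have "p \<noteq> 0"
  proof
    assume "p = 0"
    define T where "T = {\<gamma>. (\<beta> @ \<gamma>, k0) \<in> A}"
    have len\<beta>: "length \<beta> = n" using lenA[OF 0(1)] by (simp add: \<beta>_def n_def)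
    have img: "{a \<in> Ab \<beta>. snd a = k0} = (\<lambda>\<gamma>. (\<beta> @ \<gamma>, k0)) ` T"
    proof (intro equalityI subsetI)
      fix a assume "a \<in> {a \<in> Ab \<beta>. snd a = k0}"
      then have a: "a \<in> A" "take n (fst a) = \<beta>" "snd a = k0" by (auto simp: Ab_def)
      then have "a = (\<beta> @ drop n (fst a), k0)" by (metis append_take_drop_id prod.collapse)
      then show "a \<in> (\<lambda>\<gamma>. (\<beta> @ \<gamma>, k0)) ` T" using a(1) by (auto simp: T_def)
    qed (auto simp: Ab_def T_def len\<beta>)
    have inj: "inj_on (\<lambda>\<gamma>. (\<beta> @ \<gamma>, k0)) T" by (auto simp: inj_on_def)
    have finT: "finite T"
      using finite_imageD[OF _ inj] finA unfolding img[symmetric] by (auto simp: Ab_def)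
    have "(\<Sum>\<gamma>\<in>T. mconst (c (\<beta> @ \<gamma>, k0)) * mp.monomial ts \<gamma>) = Polynomial.coeff p k0"
      unfolding coeffp img sum.reindex[OF inj] by (simp add: len\<beta>)
    then have rel0: "(\<Sum>\<gamma>\<in>T. mconst (c (\<beta> @ \<gamma>, k0)) * mp.monomial ts \<gamma>) = 0" using \<open>p = 0\<close> by simp
    have lenT: "length \<gamma> = length ts" if "\<gamma> \<in> T" for \<gamma>
      using that lenA[of "\<beta> @ \<gamma>" k0] by (simp add: T_def len\<beta> n_def)
    have "drop n as0 \<in> T" using 0(1) by (simp add: T_def \<beta>_def)
    then have "mconst (c (\<beta> @ drop n as0, k0)) = (0 :: ('v, 'f) mpoly)"
      using mp.indep_monomials[OF ts finT lenT mp.alg.const rel0] by blast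
    then show False using 0(2) by (simp add: \<beta>_def)
  qed
  ultimately show ?thesis using \<open>d \<beta> = 0\<close> by (auto simp: K_def)
qed

section \<open>Gradients\<close>

definition grad :: "('v::{finite, linorder}, 'f::field) mpoly \<Rightarrow> (('v, 'f) mpoly fract, 'v) vec" where
  "grad p = (\<chi> v. Fract (partial_deriv v p) 1)"

lemma jacobian_row_eq_grad: "jacobian_row e e' = grad (binomial_gen e e')"
  by (simp add: jacobian_row_def grad_def)

lemma grad_add: "grad (p + q) = grad p + grad q"
  by (simp add: grad_def vec_eq_iff partial_deriv_add)

lemma grad_mult: "grad (p * q) = Fract p 1 *s grad q + Fract q 1 *s grad p"
  by (simp add: grad_def vec_eq_iff partial_deriv_mult)

lemma grad_const [simp]: "grad (mconst c) = 0"
  by (simp add: grad_def vec_eq_iff partial_deriv_const flip: Zero_fract_def)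

lemma grad_0 [simp]: "grad 0 = 0"
  using grad_const[of 0] by simp

lemma grad_var: "grad (var v) = axis v 1"
  by (simp add: grad_def vec_eq_iff partial_deriv_var axis_def flip: Zero_fract_def One_fract_def)

lemma grad_alg_in_span: "c \<in> mp.alg Z \<Longrightarrow> grad c \<in> vec.span (grad ` Z)"
  by (induction rule: mp.alg.induct)
    (auto simp: grad_add grad_mult intro: vec.span_base vec.span_add vec.span_scale vec.span_zero)

text \<open>Chain rule modulo the gradients of \<open>Z\<close>, which absorb those of the
  coefficients. For a relation \<open>poly p x = 0\<close> it puts the product of
  \<open>poly (pderiv p) x\<close> and \<open>grad x\<close> into their span.\<close>

lemma grad_poly:
  assumes "\<And>i. Polynomial.coeff p i \<in> mp.alg Z"
  shows "grad (poly p x) - Fract (poly (pderiv p) x) 1 *s grad x \<in> vec.span (grad ` Z)"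
  using assms
proof (induction p)
  case 0
  then show ?case by (simp add: vec.span_zero flip: Zero_fract_def)
next
  case (pCons a p)
  have coeffs: "Polynomial.coeff p i \<in> mp.alg Z" for i using pCons.prems[of "Suc i"] by simp
  have a: "a \<in> mp.alg Z" using pCons.prems[of 0] by simp
  define \<epsilon> :: "('a, 'b) mpoly \<Rightarrow> ('a, 'b) mpoly fract" where "\<epsilon> b = Fract b 1" for b
  have \<epsilon>: "\<epsilon> (b + c) = \<epsilon> b + \<epsilon> c" "\<epsilon> (b * c) = \<epsilon> b * \<epsilon> c" for b c
    by (simp_all add: \<epsilon>_def)
  have [simp]: "\<epsilon> 0 = 0" by (simp add: \<epsilon>_def Zero_fract_def)
  have "grad (poly (pCons a p) x) - \<epsilon> (poly (pderiv (pCons a p)) x) *s grad x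
    = grad a + \<epsilon> x *s (grad (poly p x) - \<epsilon> (poly (pderiv p) x) *s grad x)"
    unfolding poly_pCons pderiv_pCons poly_add grad_add grad_mult \<epsilon>_def[symmetric] \<epsilon>
    by (simp add: \<epsilon> vec.scale_left_distrib vec.scale_right_diff_distrib)
  also have "\<dots> \<in> vec.span (grad ` Z)"
    using pCons.IH[OF coeffs, folded \<epsilon>_def] grad_alg_in_span[OF a] by (intro vec.span_add vec.span_scale)
  finally show ?case by (simp only: \<epsilon>_def)
qed

text \<open>A relation of small degree is separable, after passing to a derivative if necessary.\<close>

lemma grad_in_span_of_relation:
  fixes h :: "('v::{finite, linorder}, 'f::field) mpoly"
  assumes "p \<noteq> 0" "\<And>i. Polynomial.coeff p i \<in> mp.alg Z" "poly p h = 0"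
    "\<And>k. 0 < k \<Longrightarrow> k \<le> Polynomial.degree p \<Longrightarrow> of_nat k \<noteq> (0 :: 'f)"
  shows "grad h \<in> vec.span (grad ` Z)"
  using assms
proof (induction "Polynomial.degree p" arbitrary: p rule: less_induct)
  case less
  have d: "Polynomial.degree p > 0"
  proof (rule ccontr)
    assume "\<not> Polynomial.degree p > 0"
    then obtain c where "p = [:c:]" using degree_eq_zeroE by auto
    with less.prems show False by auto
  qed
  show ?case
  proof (cases "poly (pderiv p) h = 0")
    case True
    obtain n where n: "Polynomial.degree p = Suc n" using d by (cases "Polynomial.degree p") auto
    have nz: "of_nat (Suc n) \<noteq> (0 :: ('v, 'f) mpoly)"
    proof -
      have "of_nat (Suc n) \<noteq> (0 :: 'f)" by (rule less.prems(4)) (use n in auto)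
      then have "mconst (of_nat (Suc n) :: 'f) \<noteq> (0 :: ('v, 'f) mpoly)"
        using mp.\<iota>_eq_0_iff by blast
      then show ?thesis by (simp only: mp.\<iota>_of_nat not_False_eq_True)
    qed
    \<comment> \<open>The new leading coefficient carries the factor \<open>Suc n\<close>, the
      degree of \<open>p\<close>, which is nonzero in the field by assumption; so
      \<open>pderiv p\<close> is again a nonzero relation, of smaller degree.\<close>
    have "Polynomial.coeff (pderiv p) n = of_nat (Suc n) * lead_coeff p" by (simp add: coeff_pderiv n)
    then have "Polynomial.coeff (pderiv p) n \<noteq> 0" using nz less.prems(1) by simp
    then have "pderiv p \<noteq> 0" by auto
    have "Polynomial.degree (pderiv p) \<le> n"
      by (rule degree_le) (auto simp: coeff_pderiv coeff_eq_0 n)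
    then have deg: "Polynomial.degree (pderiv p) < Polynomial.degree p" using n by simp
    show ?thesis
    proof (rule less.hyps[OF deg \<open>pderiv p \<noteq> 0\<close> _ True])
      show "Polynomial.coeff (pderiv p) i \<in> mp.alg Z" for i
        unfolding coeff_pderiv by (intro mp.alg.mult mp.alg_of_nat less.prems)
      show "of_nat k \<noteq> (0 :: 'f)" if "0 < k" "k \<le> Polynomial.degree (pderiv p)" for k
        using less.prems(4) that deg by simp
    qed
  next
    case False
    define a where "a = Fract (poly (pderiv p) h) 1"
    have "a \<noteq> 0" using False by (simp add: a_def Zero_fract_def eq_fract)
    have "- (a *s grad h) \<in> vec.span (grad ` Z)"
      using grad_poly[of p Z h] less.prems(2,3) by (simp add: a_def)
    from vec.span_neg[OF this] have "a *s grad h \<in> vec.span (grad ` Z)" by simp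
    from vec.span_scale[OF this, of "inverse a"] show ?thesis
      using \<open>a \<noteq> 0\<close> by (simp add: vec.scale_scale)
  qed
qed

context field_algebra
begin

text \<open>\<open>h\<close> adds nothing to the growth over \<open>ts\<close>. If some
  \<open>y\<close> were algebraic over \<open>h\<close>, \<open>ts\<close> and the later entries, it
  would add nothing either, and the independent list would be longer than growth permits.\<close>

lemma indep_insert_algebraic:
  assumes "algebraic_over (alg (set ts)) h" "indep {} (ys @ ts)"
  shows "indep (insert h (set ts)) ys"
  using assms(2)
proof (induction ys)
  case (Cons y ys)
  have "growth_le (insert h (set ts)) (length ts)"
    by (rule growth_le_insert_algebraic[OF growth_le_set assms(1)])
  then have g: "growth_le (set ys \<union> insert h (set ts)) (length ys + length ts)" by (rule growth_le_Un_list)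
  have "\<not> algebraic_over (alg (insert h (set ts) \<union> set ys)) y"
  proof
    assume "algebraic_over (alg (insert h (set ts) \<union> set ys)) y"
    then have "growth_le (insert y (set ys \<union> insert h (set ts))) (length ys + length ts)"
      by (intro growth_le_insert_algebraic[OF g]) (simp add: Un_commute)
    from indep_length_le[OF this _ Cons.prems] show False by (auto intro: alg.gen)
  qed
  with Cons show ?case by simp
qed simp

end

lemma dim_grad_image:
  fixes F :: "('v::{finite, linorder}, 'f::field) mpoly set"
  assumes F: "F \<subseteq> degs_in {..2}"
    and char: "\<And>k. 0 < k \<Longrightarrow> k \<le> 2 ^ CARD('v) \<Longrightarrow> of_nat k \<noteq> (0 :: 'f)"
    and ts: "set ts \<subseteq> F" "mp.indep {} ts" "\<And>f. f \<in> F \<Longrightarrow> mp.algebraic_over (mp.alg (set ts)) f"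
  shows "vec.dim (grad ` F) = length ts"
proof -
  define N where "N = CARD('v)"
  obtain xs :: "('v, 'f) mpoly list" where xs: "set xs = range var" "distinct xs"
    using finite_distinct_list[of "range (var :: 'v \<Rightarrow> ('v, 'f) mpoly)"] by auto
  have lenxs: "length xs = N"
    using distinct_card[OF xs(2)] xs(1) card_image[OF inj_var] unfolding N_def by metis
  have ixs: "mp.indep {} xs" by (rule indep_vars) (use xs in auto)
  obtain ys where ys: "set ys \<subseteq> range var" "mp.indep {} (ys @ ts)"
    "\<forall>y\<in>range var. mp.algebraic_over (mp.alg ({} \<union> set ys \<union> set ts)) y"
    using mp.indep_extend[OF _ ts(2), of "range var"] by auto
  \<comment> \<open>A transcendence basis made of the chosen generators and some variables;
    comparison with \<open>xs\<close> in both directions shows that it has as many members as there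
    are variables.\<close>
  define gs where "gs = ys @ ts"
  have "mp.growth_le (set gs \<union> range var) (length gs)"
    using ys(3) by (intro mp.growth_le_Un_algebraic mp.growth_le_set) (auto simp: gs_def)
  then have "length xs \<le> length gs"
    using ixs xs(1) by (intro mp.indep_length_le[of _ _ xs "{}"]) (auto intro: mp.alg.gen)
  moreover have "mp.growth_le (range var :: ('v, 'f) mpoly set) N"
    using mp.growth_le_set[of xs] xs(1) lenxs by simp
  then have "length gs \<le> N"
    using ys(2) by (intro mp.indep_length_le[of _ _ gs "{}"]) (auto simp: gs_def alg_range_var)
  ultimately have lengs: "length gs = N" using lenxs by simp
  \<comment> \<open>Degree bounds for the members of the basis; their product is
    \<open>2 ^ length ts\<close>, at most \<open>2 ^ N\<close>.\<close>
  define ws where "ws = replicate (length ys) 1 @ replicate (length ts) (2::nat)"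
  have ws1: "w \<ge> 1" if "w \<in> set ws" for w using that by (auto simp: ws_def)
  have lts: "length ts \<le> N" using lengs by (simp add: gs_def)
  have prod_ws: "prod_list ws \<le> 2 ^ N"
    using power_increasing[OF lts, of "2::nat"] by (simp add: ws_def prod_list_replicate)
  have var1: "x \<in> degs_in {..1}" if "x \<in> range var" for x :: "('v, 'f) mpoly"
    using that by (auto intro: degs_in_var)
  have deg: "list_all2 (\<lambda>w z. z \<in> degs_in {..w}) ws (ys @ ts)"
    unfolding ws_def using ys(1) ts(1) F var1
    by (intro list_all2_appendI) (auto simp: list_all2_conv_all_nth dest!: nth_mem)
  \<comment> \<open>Used twice: for the variables with \<open>us\<close> the whole basis and
    \<open>zs\<close> empty, and for the generators with \<open>us = ts\<close> and
    \<open>zs = ys\<close>.\<close>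
  have span: "grad h \<in> vec.span (grad ` set us)"
    if "mp.indep {} us" "mp.indep (insert h (set us)) zs" "zs @ us = ys @ ts" "h \<in> degs_in {..2}" for us zs h
  proof -
    have "length (zs @ us) = CARD('v)" "list_all2 (\<lambda>w z. z \<in> degs_in {..w}) ws (zs @ us)"
      using lengs deg that(3) by (auto simp: gs_def N_def)
    from relation_degree_bound[OF that(1,2) this ws1 that(4)]
    obtain p where p: "p \<noteq> 0" "\<forall>i. Polynomial.coeff p i \<in> mp.alg (set us)"
      "Polynomial.degree p \<le> prod_list ws" "poly p h = 0" by blast
    show ?thesis
      by (rule grad_in_span_of_relation[OF p(1) _ p(4)])
        (use p(2,3) prod_ws char N_def in \<open>auto intro: order.trans\<close>)
  qed
  have "axis v 1 \<in> vec.span (grad ` set gs)" for v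
    unfolding grad_var[symmetric]
    by (rule span[of gs _ "[]"]) (use ys(2) in \<open>auto simp: gs_def intro: degs_in_var\<close>)
  then have UNIV: "vec.span (grad ` set gs) = UNIV"
    using vec.span_mono[of cart_basis "vec.span (grad ` set gs)"] span_cart_basis
    by (auto simp: cart_basis_def vec.span_span)
  have cardle: "card (grad ` set gs) \<le> N" using card_image_le[of "set gs" grad] card_length[of gs] lengs by simp
  have dimU: "vec.dim (UNIV :: (('v, 'f) mpoly fract, 'v) vec set) = N"
    by (simp add: card_cart_basis N_def)
  \<comment> \<open>At most \<open>N\<close> vectors that span a space of dimension \<open>N\<close>
    are independent; the count also makes \<open>grad\<close> injective on the basis.\<close>
  have ind: "vec.independent (grad ` set gs)"
  proof (rule vec.card_le_dim_spanning)
    show "grad ` set gs \<subseteq> UNIV" "UNIV \<subseteq> vec.span (grad ` set gs)" using UNIV by auto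
    show "card (grad ` set gs) \<le> vec.dim (UNIV :: (('v, 'f) mpoly fract, 'v) vec set)"
      using cardle by (simp only: dimU)
  qed simp
  have "card (grad ` set gs) \<ge> vec.dim (UNIV :: (('v, 'f) mpoly fract, 'v) vec set)"
    using UNIV by (intro vec.span_card_ge_dim[of _ UNIV]) auto
  then have "card (grad ` set gs) = card (set gs)"
    using card_image_le[of "set gs" grad] card_length[of gs] lengs unfolding dimU by simp
  then have inj: "inj_on grad (set gs)" by (rule eq_card_imp_inj_on[rotated]) simp
  have sub: "set ts \<subseteq> set gs" by (auto simp: gs_def)
  have "card (grad ` set ts) = length ts"
    using card_image[OF inj_on_subset[OF inj sub]] mp.indep_distinct[OF ts(2)] by (simp add: distinct_card)
  moreover have "vec.independent (grad ` set ts)"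
    using vec.independent_mono[OF ind] sub by blast
  moreover have "grad ` F \<subseteq> vec.span (grad ` set ts)"
    using span[OF ts(2) mp.indep_insert_algebraic[OF ts(3) ys(2)]] F by blast
  ultimately show ?thesis using ts(1) by (intro vec.dim_unique[of "grad ` set ts"]) auto
qed

section \<open>Krull dimension of a subalgebra\<close>

definition subring_set :: "'a::comm_ring_1 set \<Rightarrow> bool" where
  "subring_set A \<longleftrightarrow> 1 \<in> A \<and> (\<forall>a\<in>A. - a \<in> A) \<and> (\<forall>a\<in>A. \<forall>b\<in>A. a + b \<in> A) \<and> (\<forall>a\<in>A. \<forall>b\<in>A. a * b \<in> A)"

abbreviation ring_on :: "'a::comm_ring_1 set \<Rightarrow> 'a ring" where
  "ring_on A \<equiv> ring_of_type_algebra\<lparr>carrier := A\<rparr>"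

lemma ring_of_type_algebra_simps:
  "carrier ring_of_type_algebra = UNIV" "a \<otimes>\<^bsub>ring_of_type_algebra\<^esub> b = a * b"
  "a \<oplus>\<^bsub>ring_of_type_algebra\<^esub> b = a + b" "\<one>\<^bsub>ring_of_type_algebra\<^esub> = 1" "\<zero>\<^bsub>ring_of_type_algebra\<^esub> = 0"
  for a b :: "'a::comm_ring_1"
  by (simp_all add: ring_of_type_algebra_def)

lemma cring_ring_on:
  assumes "subring_set A"
  shows "cring (ring_on A)"
proof -
  interpret R: cring "ring_of_type_algebra :: 'a ring" by (rule cring_from_type_algebra)
  have neg: "\<ominus>\<^bsub>ring_of_type_algebra\<^esub> a = - a" for a :: 'a
    by (rule R.minus_equality) (simp_all add: ring_of_type_algebra_simps)
  have "subring A ring_of_type_algebra"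
    by (rule R.subringI) (use assms in \<open>auto simp: subring_set_def ring_of_type_algebra_simps neg\<close>)
  then show ?thesis using R.subcringI' R.subcring_iff by (metis subring.axioms(1) subringE(1))
qed

lemma ring_on_uminus:
  assumes "subring_set A" "a \<in> A"
  shows "\<ominus>\<^bsub>ring_on A\<^esub> a = - a"
proof -
  interpret R: cring "ring_on A" by (rule cring_ring_on[OF assms(1)])
  show ?thesis
    by (rule R.minus_equality) (use assms in \<open>simp_all add: ring_of_type_algebra_simps subring_set_def\<close>)
qed

text \<open>Translates ideals of the record \<open>ring_on A\<close> into the operations of the
  type; closure under negation is multiplication by -1, an element of \<open>A\<close>.\<close>

lemma ideal_ring_on_iff:
  assumes A: "subring_set A"
  shows "ideal J (ring_on A) \<longleftrightarrow>
    J \<subseteq> A \<and> 0 \<in> J \<and> (\<forall>a\<in>J. \<forall>b\<in>J. a + b \<in> J) \<and> (\<forall>a\<in>A. \<forall>b\<in>J. a * b \<in> J)" (is "?L \<longleftrightarrow> ?R")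
proof
  interpret R: cring "ring_on A" by (rule cring_ring_on[OF A])
  assume ?L
  then interpret ideal J "ring_on A" .
  show ?R
    using a_subset zero_closed a_closed I_l_closed by (auto simp: ring_of_type_algebra_simps)
next
  interpret R: cring "ring_on A" by (rule cring_ring_on[OF A])
  assume J: ?R
  have "- a \<in> J" if "a \<in> J" for a
  proof -
    have "(- 1) * a \<in> J" using J that A unfolding subring_set_def by blast
    then show ?thesis by simp
  qed
  then have "\<ominus>\<^bsub>ring_on A\<^esub> a \<in> J" if "a \<in> J" for a
    using that J ring_on_uminus[OF A] by auto
  then have "subgroup J (add_monoid (ring_on A))"
    using J by (intro R.add.subgroupI) (auto simp: ring_of_type_algebra_simps)
  then show ?L
  proof (intro idealI R.ring_axioms)
    fix a x assume "a \<in> J" "x \<in> carrier (ring_on A)"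
    then have "x * a \<in> J" using J by (simp add: ring_of_type_algebra_simps)
    then show "x \<otimes>\<^bsub>ring_on A\<^esub> a \<in> J" "a \<otimes>\<^bsub>ring_on A\<^esub> x \<in> J"
      by (simp_all add: ring_of_type_algebra_simps mult.commute)
  qed
qed

lemma ring_on_UNIV: "ring_on UNIV = ring_of_type_algebra"
  by (simp add: ring_of_type_algebra_def)

lemma subring_set_UNIV: "subring_set UNIV"
  by (simp add: subring_set_def)

lemma ideal_type_iff:
  "ideal J (ring_of_type_algebra :: 'a::comm_ring_1 ring) \<longleftrightarrow>
    0 \<in> J \<and> (\<forall>a\<in>J. \<forall>b\<in>J. a + b \<in> J) \<and> (\<forall>a. \<forall>b\<in>J. a * b \<in> J)"
  using ideal_ring_on_iff[OF subring_set_UNIV] unfolding ring_on_UNIV by simp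

text \<open>Preimages of primes are prime, and surjectivity keeps the inclusions strict.\<close>

lemma ring_isomorphic_krull_dim_le:
  assumes "cring R" "cring S" "h \<in> ring_iso R S"
  shows "krull_dim S \<le> krull_dim R"
proof -
  have h: "h \<in> ring_hom R S" "bij_betw h (carrier R) (carrier S)"
    using assms(3) by (auto simp: ring_iso_def)
  interpret hom: ring_hom_ring R S h
    using assms(1,2) h(1) by (intro ring_hom_ringI2) (auto simp: cring_def)
  show ?thesis
    unfolding krull_dim_def
  proof (rule Sup_subset_mono, rule subsetI)
    fix e assume "e \<in> {enat d |d. \<exists>P. (\<forall>i\<le>d. primeideal (P i) S) \<and> (\<forall>i<d. P i \<subset> P (Suc i))}"
    then obtain d P where P: "e = enat d" "\<forall>i\<le>d. primeideal (P i) S" "\<forall>i<d. P i \<subset> P (Suc i)" by blast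
    define Q where "Q i = {r \<in> carrier R. h r \<in> P i}" for i
    have 1: "\<forall>i\<le>d. primeideal (Q i) R"
      unfolding Q_def using P(2) hom.primeideal_vimage[OF assms(1)] by blast
    have 2: "\<forall>i<d. Q i \<subset> Q (Suc i)"
    proof (intro allI impI)
      fix i assume i: "i < d"
      then obtain s where s: "s \<in> P (Suc i)" "s \<notin> P i" using P(3) by blast
      have "P (Suc i) \<subseteq> carrier S"
        using P(2) i by (intro additive_subgroup.a_subset ideal.axioms(1) primeideal.axioms(1)) auto
      moreover have "h ` carrier R = carrier S" using h(2) by (simp add: bij_betw_def)
      ultimately have "s \<in> h ` carrier R" using s(1) by blast
      then obtain r where r: "r \<in> carrier R" "h r = s" by blast
      have "P i \<subseteq> P (Suc i)" using P(3) i by blast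
      then have "Q i \<subseteq> Q (Suc i)" by (auto simp: Q_def)
      moreover have "r \<in> Q (Suc i)" "r \<notin> Q i" using r s by (auto simp: Q_def)
      ultimately show "Q i \<subset> Q (Suc i)" by blast
    qed
    show "e \<in> {enat d |d. \<exists>P. (\<forall>i\<le>d. primeideal (P i) R) \<and> (\<forall>i<d. P i \<subset> P (Suc i))}"
      using P(1) 1 2 by (intro CollectI exI[of _ d] exI[of _ Q] conjI)
  qed
qed

lemma krull_dim_ring_iso:
  assumes "cring R" "cring S" "R \<simeq> S"
  shows "krull_dim R = krull_dim S"
proof -
  obtain h where h: "h \<in> ring_iso R S" using assms(3) by (auto simp: is_ring_iso_def)
  have "inv_into (carrier R) h \<in> ring_iso S R"
    using ring_iso_set_sym[OF _ h] assms(1) by (simp add: cring_def)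
  with h show ?thesis using ring_isomorphic_krull_dim_le assms(1,2) by (metis antisym)
qed

context field_algebra
begin

lemma subring_set_alg: "subring_set (alg Z)"
  by (auto simp: subring_set_def intro: alg_uminus alg.intros)

lemma primeideal_alg_iff: "primeideal P (ring_on (alg Z)) \<longleftrightarrow> prime_in (alg Z) P"
proof -
  have idl: "ideal P (ring_on (alg Z)) \<longleftrightarrow> P \<subseteq> alg Z \<and> 0 \<in> P \<and>
    (\<forall>a\<in>P. \<forall>b\<in>P. a + b \<in> P) \<and> (\<forall>a\<in>alg Z. \<forall>b\<in>P. a * b \<in> P)"
    by (rule ideal_ring_on_iff[OF subring_set_alg])
  show ?thesis
  proof
    assume P: "primeideal P (ring_on (alg Z))"
    have "1 \<notin> P"
    proof
      assume "1 \<in> P"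
      then have "a \<in> P" if "a \<in> alg Z" for a
        using idl primeideal.axioms(1)[OF P] that by (metis mult.right_neutral)
      moreover have "P \<subseteq> alg Z" using idl primeideal.axioms(1)[OF P] by blast
      ultimately show False using primeideal.I_notcarr[OF P] by (auto simp: ring_of_type_algebra_simps)
    qed
    then show "prime_in (alg Z) P"
      using idl primeideal.axioms(1)[OF P] primeideal.I_prime[OF P]
      by (auto simp: prime_in_def ring_of_type_algebra_simps)
  next
    assume P: "prime_in (alg Z) P"
    show "primeideal P (ring_on (alg Z))"
    proof (rule primeidealI)
      show "ideal P (ring_on (alg Z))" using P unfolding idl prime_in_def by blast
      show "cring (ring_on (alg Z))" by (rule cring_ring_on[OF subring_set_alg])
      show "carrier (ring_on (alg Z)) \<noteq> P" using P by (auto simp: prime_in_def ring_of_type_algebra_simps)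
    qed (use P in \<open>auto simp: prime_in_def ring_of_type_algebra_simps\<close>)
  qed
qed

end

lemma krull_dim_alg:
  fixes F :: "('v::{finite, linorder}, 'f::field) mpoly set"
  assumes F: "finite F" and ts: "set ts \<subseteq> F" "mp.indep {} ts"
    "\<And>f. f \<in> F \<Longrightarrow> mp.algebraic_over (mp.alg (set ts)) f"
  shows "krull_dim (ring_on (mp.alg F)) = enat (length ts)"
proof -
  have "mp.growth_le (set ts \<union> F) (length ts)"
    using mp.growth_le_Un_algebraic[OF F mp.growth_le_set ts(3)] .
  moreover have "set ts \<union> F = F" using ts(1) by blast
  ultimately have growth: "mp.growth_le F (length ts)" by simp
  obtain xs :: "('v, 'f) mpoly list" where xs: "set xs = range var" "distinct xs"
    using finite_distinct_list[of "range (var :: 'v \<Rightarrow> ('v, 'f) mpoly)"] by auto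
  have ixs: "mp.indep {} xs" by (rule indep_vars) (use xs in auto)
  obtain Q where Q: "\<forall>i\<le>length ts. \<exists>\<psi>. mp.alg_hom \<psi> \<and> Q i = mp.hom_kernel F \<psi>"
    "\<forall>i<length ts. Q i \<subset> Q (Suc i)"
  proof -
    have "set xs \<subseteq> range var" "(\<lambda>x. x) ` mp.alg F \<subseteq> mp.alg (set xs)" "set ts \<subseteq> (\<lambda>x. x) ` F"
      using ts(1) xs(1) by (auto simp: alg_range_var)
    \<comment> \<open>The chain starts from the identity, whose kernel is the zero ideal.\<close>
    then have "\<exists>Q. Q 0 = mp.hom_kernel F (\<lambda>x. x) \<and>
      (\<forall>i\<le>length ts. \<exists>\<psi>. mp.alg_hom \<psi> \<and> Q i = mp.hom_kernel F \<psi>) \<and> (\<forall>i<length ts. Q i \<subset> Q (Suc i))"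
      by (intro mp.kernel_chain[OF _ _ ixs mp.alg_hom_id _ _ ts(2)]) (rule subst_variable)
    then show thesis by (elim exE conjE) (rule that)
  qed
  have "enat (length ts) \<le> krull_dim (ring_on (mp.alg F))"
    unfolding krull_dim_def
  proof (rule Sup_upper)
    have "\<forall>i\<le>length ts. primeideal (Q i) (ring_on (mp.alg F))"
      using Q(1) mp.prime_in_hom_kernel unfolding mp.primeideal_alg_iff by metis
    then show "enat (length ts) \<in> {enat d |d. \<exists>P. (\<forall>i\<le>d. primeideal (P i) (ring_on (mp.alg F))) \<and>
      (\<forall>i<d. P i \<subset> P (Suc i))}" using Q(2) by blast
  qed
  moreover have "krull_dim (ring_on (mp.alg F)) \<le> enat (length ts)"
    unfolding krull_dim_def
  proof (rule Sup_least)
    fix e assume "e \<in> {enat d |d. \<exists>P. (\<forall>i\<le>d. primeideal (P i) (ring_on (mp.alg F))) \<and>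
      (\<forall>i<d. P i \<subset> P (Suc i))}"
    then obtain d P where P: "e = enat d" "\<And>i. i \<le> d \<Longrightarrow> mp.prime_in (mp.alg F) (P i)"
      "\<And>i. i < d \<Longrightarrow> P i \<subset> P (Suc i)" unfolding mp.primeideal_alg_iff by blast
    then show "e \<le> enat (length ts)" using mp.prime_chain_length_le[OF growth, of d P] by simp
  qed
  ultimately show ?thesis by (rule antisym[rotated])
qed

section \<open>The special fiber ring\<close>

text \<open>The homogeneous component of degree \<open>d\<close>.\<close>

definition hpart :: "nat \<Rightarrow> ('v::finite, 'f::field) mpoly \<Rightarrow> ('v, 'f) mpoly" where
  "hpart d p = (\<Sum>t\<in>{t \<in> Poly_Mapping.keys p. tdeg t = d}. Poly_Mapping.single t (Poly_Mapping.lookup p t))"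

lemma lookup_hpart:
  "Poly_Mapping.lookup (hpart d p) t = (if tdeg t = d then Poly_Mapping.lookup p t else 0)"
  by (auto simp: hpart_def lookup_sum lookup_single when_def in_keys_iff)

lemma hpart_add: "hpart d (p + q) = hpart d p + hpart d q"
  by (rule poly_mapping_eqI) (simp add: lookup_hpart lookup_add)

lemma hpart_0 [simp]: "hpart d 0 = 0"
  by (rule poly_mapping_eqI) (simp add: lookup_hpart)

lemma hpart_sum: "hpart d (sum f A) = (\<Sum>i\<in>A. hpart d (f i))"
  by (induction A rule: infinite_finite_induct) (simp_all add: hpart_add)

lemma hpart_degs: "hpart d p \<in> degs_in {d}"
  by (auto simp: degs_in_def in_keys_iff lookup_hpart split: if_splits)

lemma hpart_eq_0: "p \<in> degs_in A \<Longrightarrow> d \<notin> A \<Longrightarrow> hpart d p = 0"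
  by (rule poly_mapping_eqI) (auto simp: lookup_hpart degs_in_def in_keys_iff)

lemma hpart_id: "p \<in> degs_in {d} \<Longrightarrow> hpart d p = p"
  by (rule poly_mapping_eqI) (auto simp: lookup_hpart degs_in_def in_keys_iff)

lemma hpart_remainder:
  assumes "p \<in> degs_in {d..}"
  shows "p - hpart d p \<in> degs_in {Suc d..}"
proof -
  have "tdeg t \<ge> Suc d" if "Poly_Mapping.lookup (p - hpart d p) t \<noteq> 0" for t
  proof -
    have "tdeg t \<noteq> d" "Poly_Mapping.lookup p t \<noteq> 0"
      using that by (auto simp: lookup_minus lookup_hpart split: if_splits)
    moreover from this(2) have "tdeg t \<ge> d" using assms by (auto simp: degs_in_def in_keys_iff)
    ultimately show ?thesis by simp
  qed
  then show ?thesis by (auto simp: degs_in_def in_keys_iff)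
qed

text \<open>Lowest components multiply: every other contribution to the product has degree above
  \<open>a + b\<close>.\<close>

lemma hpart_mult:
  assumes "p \<in> degs_in {a..}" "q \<in> degs_in {b..}"
  shows "hpart (a + b) (p * q) = hpart a p * hpart b q"
proof -
  define p' q' where "p' = p - hpart a p" and "q' = q - hpart b q"
  have p': "p' \<in> degs_in {Suc a..}" and q': "q' \<in> degs_in {Suc b..}"
    using hpart_remainder assms by (auto simp: p'_def q'_def)
  have "p * q = hpart a p * hpart b q + (hpart a p * q' + p' * q)"
    by (simp add: p'_def q'_def algebra_simps)
  moreover have "hpart a p * hpart b q \<in> degs_in {a + b}"
    by (rule degs_in_mult[OF hpart_degs hpart_degs]) auto
  moreover have "hpart a p * q' + p' * q \<in> degs_in {Suc (a + b)..}"
    by (intro degs_in_add degs_in_mult[OF hpart_degs q'] degs_in_mult[OF p' assms(2)]) auto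
  then have "hpart (a + b) (hpart a p * q' + p' * q) = 0" by (rule hpart_eq_0) simp
  ultimately show ?thesis by (simp only: hpart_add hpart_id add_0_right)
qed

lemma ideal_degs_in: "ideal (degs_in {d..}) (ring_of_type_algebra :: ('v::finite, 'f::field) mpoly ring)"
  unfolding ideal_type_iff
proof (intro conjI allI ballI)
  fix a b :: "('v, 'f) mpoly" assume "b \<in> degs_in {d..}"
  moreover have "a \<in> degs_in UNIV" by (simp add: degs_in_def)
  ultimately show "a * b \<in> degs_in {d..}" by (intro degs_in_mult[of a UNIV b "{d..}"]) auto
qed (auto intro: degs_in_add)

section \<open>Products and powers of ideals\<close>

lemma ideal_prod_degs_in:
  fixes J K :: "('v::finite, 'f::field) mpoly set"
  assumes "J \<subseteq> degs_in {a..}" "K \<subseteq> degs_in {b..}"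
  shows "ideal_prod ring_of_type_algebra J K \<subseteq> degs_in {a + b..}"
proof
  fix x assume "x \<in> ideal_prod ring_of_type_algebra J K"
  then show "x \<in> degs_in {a + b..}"
  proof induction
    case (prod i j)
    then have "i * j \<in> degs_in {a + b..}"
      using assms by (intro degs_in_mult[of i "{a..}" j "{b..}"]) auto
    then show ?case by (simp add: ring_of_type_algebra_simps)
  qed (auto simp: ring_of_type_algebra_simps intro: degs_in_add)
qed

lemma ideal_prod_mult:
  fixes J K :: "'a::comm_ring_1 set"
  assumes "x \<in> ideal_prod ring_of_type_algebra J K" "\<And>i j. i \<in> J \<Longrightarrow> j \<in> K \<Longrightarrow> b * (i * j) \<in> T"
    "\<And>s t. s \<in> T \<Longrightarrow> t \<in> T \<Longrightarrow> s + t \<in> T"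
  shows "b * x \<in> T"
  using assms(1)
  by induction (auto simp: ring_of_type_algebra_simps distrib_left intro: assms(2,3))

lemma ideal_prodI: "i \<in> J \<Longrightarrow> j \<in> K \<Longrightarrow> i * j \<in> ideal_prod ring_of_type_algebra J K"
  for i j :: "'a::comm_ring_1"
  using ideal_prod.prod[of i J j K ring_of_type_algebra] by (simp add: ring_of_type_algebra_simps)

lemma ideal_power_0: "ideal_power I 0 = UNIV"
  and ideal_power_Suc: "ideal_power I (Suc k) = ideal_prod ring_of_type_algebra (ideal_power I k) I"
  by (simp_all add: ideal_power_def nat_pow_def ideals_set_def ring_of_type_algebra_simps)

interpretation type_cring: cring "ring_of_type_algebra :: 'a::comm_ring_1 ring"
  by (rule cring_from_type_algebra)

lemma ideal_ideal_power: "ideal I ring_of_type_algebra \<Longrightarrow> ideal (ideal_power I k) ring_of_type_algebra"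
proof (induction k)
  case 0
  then show ?case by (simp add: ideal_power_0 ideal_type_iff)
next
  case (Suc k)
  then show ?case by (simp add: ideal_power_Suc type_cring.ideal_prod_is_ideal)
qed

lemma ideal_power_mult:
  assumes "ideal I ring_of_type_algebra" "a \<in> ideal_power I i" "b \<in> ideal_power I j"
  shows "a * b \<in> ideal_power I (i + j)"
  using assms(3)
proof (induction j arbitrary: b)
  case 0
  then show ?case
    using ideal_ideal_power[OF assms(1), of i] assms(2) by (simp add: ideal_type_iff mult.commute[of a])
next
  case (Suc j)
  have add: "s + t \<in> ideal_power I (i + Suc j)" if "s \<in> ideal_power I (i + Suc j)" "t \<in> ideal_power I (i + Suc j)" for s t
    using ideal_ideal_power[OF assms(1), of "i + Suc j"] that by (simp add: ideal_type_iff)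
  show ?case
  proof (rule ideal_prod_mult[OF Suc.prems[unfolded ideal_power_Suc] _ add])
    fix x y assume "x \<in> ideal_power I j" "y \<in> I"
    then have "(a * x) * y \<in> ideal_power I (i + Suc j)"
      using Suc.IH by (simp add: ideal_power_Suc ideal_prodI)
    then show "a * (x * y) \<in> ideal_power I (i + Suc j)" by (simp add: mult.assoc)
  qed
qed

lemma graded_maximal_ideal_ideal: "ideal graded_maximal_ideal ring_of_type_algebra"
  unfolding graded_maximal_ideal_def
  by (rule type_cring.genideal_ideal) (simp add: ring_of_type_algebra_simps)

lemma var_in_graded_maximal_ideal: "var v \<in> graded_maximal_ideal"
  unfolding graded_maximal_ideal_def
  using type_cring.genideal_self[of "range var"] by (auto simp: ring_of_type_algebra_simps)

lemma graded_maximal_ideal_degs: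
  "(graded_maximal_ideal :: ('v::finite, 'f::field) mpoly set) \<subseteq> degs_in {1..}"
  unfolding graded_maximal_ideal_def
  by (rule type_cring.genideal_minimal[OF ideal_degs_in]) (auto intro: degs_in_var)

text \<open>The residue field of the maximal ideal is the ground field. Hence multipliers act on
  $I^k$ modulo $M I^k$ as scalars, which leaves linear combinations of products of
  generators.\<close>

lemma mpoly_const_plus_maximal:
  fixes a :: "('v::{finite, linorder}, 'f::field) mpoly"
  obtains c m where "a = mconst c + m" "m \<in> graded_maximal_ideal"
proof -
  have M: "0 \<in> M" "\<And>a b. a \<in> M \<Longrightarrow> b \<in> M \<Longrightarrow> a + b \<in> M" "\<And>a b. b \<in> M \<Longrightarrow> a * b \<in> M"
    if "M = graded_maximal_ideal" for M :: "('v, 'f) mpoly set"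
    using graded_maximal_ideal_ideal that by (auto simp: ideal_type_iff)
  note M = M[OF refl]
  have "\<exists>c m. a = mconst c + m \<and> m \<in> graded_maximal_ideal"
    using alg_range_var[of a]
  proof induction
    case (const c)
    then show ?case using M(1) by (metis add_0_right)
  next
    case (gen z)
    then show ?case using var_in_graded_maximal_ideal by (metis add_0 imageE single_zero)
  next
    case (add a b)
    then obtain c m d n where "a = mconst c + m" "b = mconst d + n"
      and mn: "m \<in> graded_maximal_ideal" "n \<in> graded_maximal_ideal" by blast
    then have "a + b = mconst (c + d) + (m + n)" by (simp add: single_add)
    then show ?case using M(2)[OF mn] by blast
  next
    case (mult a b)
    then obtain c m d n where ab: "a = mconst c + m" "b = mconst d + n"
      and mn: "m \<in> graded_maximal_ideal" "n \<in> graded_maximal_ideal" by blast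
    have "a * b = mconst (c * d) + (mconst d * m + a * n)"
      unfolding ab mp.\<iota>_mult by (simp only: algebra_simps)
    then show ?case using M(2)[OF M(3)[OF mn(1)] M(3)[OF mn(2)]] by blast
  qed
  then show thesis using that by blast
qed

section \<open>The initial form map for generators of one degree\<close>

locale homogeneous_generators =
  fixes F :: "('v::{finite, linorder}, 'f::field) mpoly set" and d :: nat
  assumes F_degs: "F \<subseteq> degs_in {d}"
begin

definition I :: "('v, 'f) mpoly set" where
  "I = genideal ring_of_type_algebra F"

abbreviation M :: "('v, 'f) mpoly set" where
  "M \<equiv> graded_maximal_ideal"

abbreviation MI :: "nat \<Rightarrow> ('v, 'f) mpoly set" where
  "MI k \<equiv> ideal_prod ring_of_type_algebra M (ideal_power I k)"

lemma ideal_I: "ideal I ring_of_type_algebra"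
  unfolding I_def by (rule type_cring.genideal_ideal) (simp add: ring_of_type_algebra_simps)

lemma F_subset_I: "F \<subseteq> I"
  unfolding I_def by (rule type_cring.genideal_self) (simp add: ring_of_type_algebra_simps)

lemma ideal_pow: "ideal (ideal_power I k) ring_of_type_algebra"
  by (rule ideal_ideal_power[OF ideal_I])

lemma ideal_MI: "ideal (MI k) ring_of_type_algebra"
  by (rule type_cring.ideal_prod_is_ideal[OF graded_maximal_ideal_ideal ideal_pow])

lemma pow_simps:
  "0 \<in> ideal_power I k" "a \<in> ideal_power I k \<Longrightarrow> b \<in> ideal_power I k \<Longrightarrow> a + b \<in> ideal_power I k"
  "b \<in> ideal_power I k \<Longrightarrow> c * b \<in> ideal_power I k"
  using ideal_pow[of k] by (auto simp: ideal_type_iff)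

lemma MI_simps:
  "0 \<in> MI k" "a \<in> MI k \<Longrightarrow> b \<in> MI k \<Longrightarrow> a + b \<in> MI k" "b \<in> MI k \<Longrightarrow> c * b \<in> MI k"
  using ideal_MI[of k] by (auto simp: ideal_type_iff)

lemma MI_subset: "MI k \<subseteq> ideal_power I k"
proof
  fix x assume "x \<in> MI k"
  then have "1 * x \<in> ideal_power I k"
    by (rule ideal_prod_mult) (auto intro: pow_simps)
  then show "x \<in> ideal_power I k" by simp
qed

lemma span_subset_pow: "B \<subseteq> ideal_power I k \<Longrightarrow> mp.V.span B \<subseteq> ideal_power I k"
proof
  fix x assume B: "B \<subseteq> ideal_power I k" and "x \<in> mp.V.span B"
  from this(2) show "x \<in> ideal_power I k"
    by (induction rule: mp.V.span_induct_alt) (use B in \<open>auto intro: pow_simps\<close>)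
qed

lemma products_subset_pow: "mp.products F k \<subseteq> ideal_power I k"
proof (induction k)
  case 0
  show ?case by (simp add: ideal_power_0)
next
  case (Suc k)
  have "b * v \<in> ideal_power I (Suc k)" if "b \<in> F" "v \<in> mp.products F k" for b v
    using ideal_prodI[of v "ideal_power I k" b I] that Suc F_subset_I
    by (auto simp: ideal_power_Suc mult.commute)
  then show ?case by (auto simp: mp.products_Suc)
qed

lemma span_products_subset_pow: "mp.V.span (mp.products F k) \<subseteq> ideal_power I k"
  by (rule span_subset_pow[OF products_subset_pow])

lemma products_degs: "mp.products F k \<subseteq> degs_in {d * k}"
proof (induction k)
  case 0
  show ?case by (auto intro: degs_in_one)
next
  case (Suc k)
  have "b * v \<in> degs_in {d * Suc k}" if "b \<in> F" "v \<in> mp.products F k" for b v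
    by (rule degs_in_mult[of _ "{d}" _ "{d * k}"]) (use that Suc F_degs in auto)
  then show ?case by (auto simp: mp.products_Suc)
qed

lemma span_products_degs: "mp.V.span (mp.products F k) \<subseteq> degs_in {d * k}"
  using degs_in_span[OF products_degs] by blast

lemma I_degs: "I \<subseteq> degs_in {d..}"
  unfolding I_def
  by (rule type_cring.genideal_minimal[OF ideal_degs_in]) (use F_degs degs_in_mono[of "{d}" "{d..}"] in auto)

lemma pow_degs: "ideal_power I k \<subseteq> degs_in {d * k..}"
proof (induction k)
  case 0
  show ?case by (auto simp: degs_in_def)
next
  case (Suc k)
  from ideal_prod_degs_in[OF this I_degs] show ?case by (simp add: ideal_power_Suc add.commute)
qed

lemma MI_degs: "MI k \<subseteq> degs_in {Suc (d * k)..}"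
  using ideal_prod_degs_in[OF graded_maximal_ideal_degs pow_degs] by simp

text \<open>The sums on the right form an ideal that contains \<open>F\<close>: a multiplier splits
  into a constant, which preserves the span, and an element of \<open>M\<close>, which sends the
  span into $M I$.\<close>

lemma I_decomp: "a \<in> I \<Longrightarrow> \<exists>x y. a = x + y \<and> x \<in> mp.V.span F \<and> y \<in> ideal_prod ring_of_type_algebra M I"
proof -
  define T where "T = {x + y | x y. x \<in> mp.V.span F \<and> y \<in> ideal_prod ring_of_type_algebra M I}"
  have "ideal (ideal_prod ring_of_type_algebra M I) ring_of_type_algebra"
    by (rule type_cring.ideal_prod_is_ideal[OF graded_maximal_ideal_ideal ideal_I])
  then have P: "0 \<in> ideal_prod ring_of_type_algebra M I"
    "\<And>a b. a \<in> ideal_prod ring_of_type_algebra M I \<Longrightarrow> b \<in> ideal_prod ring_of_type_algebra M I \<Longrightarrow>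
      a + b \<in> ideal_prod ring_of_type_algebra M I"
    "\<And>c b. b \<in> ideal_prod ring_of_type_algebra M I \<Longrightarrow> c * b \<in> ideal_prod ring_of_type_algebra M I"
    by (auto simp: ideal_type_iff)
  have span_I: "mp.V.span F \<subseteq> I"
  proof
    fix x assume "x \<in> mp.V.span F"
    then show "x \<in> I"
      by (induction rule: mp.V.span_induct_alt) (use F_subset_I ideal_I in \<open>auto simp: ideal_type_iff\<close>)
  qed
  have "ideal T ring_of_type_algebra"
    unfolding ideal_type_iff
  proof (intro conjI allI ballI)
    show "0 \<in> T" using mp.V.span_zero[of F] P(1) unfolding T_def by force
  next
    fix a b assume "a \<in> T" "b \<in> T"
    then obtain x y x' y' where "a = x + y" "b = x' + y'"
      and xy: "x \<in> mp.V.span F" "x' \<in> mp.V.span F"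
        "y \<in> ideal_prod ring_of_type_algebra M I" "y' \<in> ideal_prod ring_of_type_algebra M I"
      unfolding T_def by blast
    then have "a + b = (x + x') + (y + y')" by (simp add: algebra_simps)
    then show "a + b \<in> T" using mp.V.span_add[OF xy(1,2)] P(2)[OF xy(3,4)] unfolding T_def by blast
  next
    fix s b assume "b \<in> T"
    then obtain x y where b: "b = x + y"
      and xy: "x \<in> mp.V.span F" "y \<in> ideal_prod ring_of_type_algebra M I"
      unfolding T_def by blast
    obtain c m where s: "s = mconst c + m" "m \<in> M" by (rule mpoly_const_plus_maximal)
    have "s * b = mconst c * x + (m * x + s * y)" unfolding b s(1) by (simp only: algebra_simps)
    moreover have "m * x \<in> ideal_prod ring_of_type_algebra M I"
      using s(2) xy(1) span_I by (intro ideal_prodI) auto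
    ultimately show "s * b \<in> T"
      using mp.V.span_scale[OF xy(1)] P(2)[OF _ P(3)[OF xy(2)]] unfolding T_def by blast
  qed
  moreover have "F \<subseteq> T"
  proof
    fix f assume "f \<in> F"
    then have "f = f + 0 \<and> f \<in> mp.V.span F" by (simp add: mp.V.span_base)
    then show "f \<in> T" using P(1) unfolding T_def by blast
  qed
  ultimately have "I \<subseteq> T" unfolding I_def by (rule type_cring.genideal_minimal)
  then show "a \<in> I \<Longrightarrow> ?thesis" unfolding T_def by blast
qed

text \<open>In the expansion of \<open>(x + y) * (u + v)\<close> everything except
  \<open>x * u\<close> has a factor from \<open>M\<close> and falls into
  \<open>MI (Suc k)\<close>.\<close>

lemma pow_decomp: "a \<in> ideal_power I k \<Longrightarrow> \<exists>x y. a = x + y \<and> x \<in> mp.V.span (mp.products F k) \<and> y \<in> MI k"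
proof (induction k arbitrary: a)
  case 0
  obtain c m where a: "a = mconst c + m" "m \<in> M" by (rule mpoly_const_plus_maximal)
  have "mconst c \<in> mp.V.span {1}" using mp.V.span_scale[OF mp.V.span_base[of 1 "{1}"], of c] by simp
  moreover have "m \<in> MI 0" using ideal_prodI[OF a(2), of 1 UNIV] by (simp add: ideal_power_0)
  ultimately show ?case using a(1) by auto
next
  case (Suc k)
  from Suc.prems have "a \<in> ideal_prod ring_of_type_algebra (ideal_power I k) I"
    by (simp only: ideal_power_Suc)
  then show ?case
  proof induction
    case (prod i j)
    obtain x y where i: "i = x + y" "x \<in> mp.V.span (mp.products F k)" "y \<in> MI k"
      using Suc.IH prod(1) by blast
    obtain u v where j: "j = u + v" "u \<in> mp.V.span F" "v \<in> ideal_prod ring_of_type_algebra M I"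
      using I_decomp prod(2) by blast
    have "u \<in> mp.V.span (mp.products F 1)"
      using j(2) mp.V.span_mono[of F "mp.products F 1"] by (auto simp: mp.products_Suc)
    then have xu: "x * u \<in> mp.V.span (mp.products F (Suc k))"
      using mp.span_products_mult[OF i(2), of u 1] by simp
    have "x * v \<in> MI (Suc k)"
    proof (rule ideal_prod_mult[OF j(3) _ MI_simps(2)])
      fix m w assume mw: "m \<in> M" "w \<in> I"
      have "m * (x * w) \<in> MI (Suc k)"
        using mw i(2) span_products_subset_pow by (intro ideal_prodI) (auto simp: ideal_power_Suc intro: ideal_prodI)
      then show "x * (m * w) \<in> MI (Suc k)" by (simp add: mult.left_commute)
    qed
    moreover have "j * y \<in> MI (Suc k)"
    proof (rule ideal_prod_mult[OF i(3) _ MI_simps(2)])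
      fix m w assume mw: "m \<in> M" "w \<in> ideal_power I k"
      have "m * (w * j) \<in> MI (Suc k)"
        using mw prod(2) by (intro ideal_prodI) (auto simp: ideal_power_Suc intro: ideal_prodI)
      then show "j * (m * w) \<in> MI (Suc k)" by (simp add: ac_simps)
    qed
    ultimately have "x * v + j * y \<in> MI (Suc k)" by (rule MI_simps(2))
    moreover have "i * j = x * u + (x * v + j * y)" unfolding i(1) j(1) by (simp only: algebra_simps)
    ultimately show ?case using xu unfolding ring_of_type_algebra_simps by (intro exI conjI)
  next
    case (sum s t)
    then obtain x y x' y' where "s = x + y" "t = x' + y'"
      and xy: "x \<in> mp.V.span (mp.products F (Suc k))" "x' \<in> mp.V.span (mp.products F (Suc k))"
        "y \<in> MI (Suc k)" "y' \<in> MI (Suc k)"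
      by blast
    then have "s + t = (x + x') + (y + y')" by (simp add: algebra_simps)
    then show ?case
      using mp.V.span_add[OF xy(1,2)] MI_simps(2)[OF xy(3,4)] unfolding ring_of_type_algebra_simps by blast
  qed
qed

text \<open>The two summands of \<open>pow_decomp\<close> are told apart by degree: the first lives
  in degree \<open>d * k\<close>, the second in larger degrees.\<close>

lemma hpart_pow:
  assumes "a \<in> ideal_power I k"
  shows "hpart (d * k) a \<in> mp.V.span (mp.products F k)" "a - hpart (d * k) a \<in> MI k"
proof -
  obtain x y where a: "a = x + y" "x \<in> mp.V.span (mp.products F k)" "y \<in> MI k"
    using pow_decomp[OF assms] by blast
  have "hpart (d * k) x = x" using a(2) span_products_degs by (intro hpart_id) auto
  moreover have "hpart (d * k) y = 0" by (rule hpart_eq_0[of _ "{Suc (d * k)..}"]) (use a(3) MI_degs in auto)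
  ultimately have "hpart (d * k) a = x" by (simp add: a(1) hpart_add)
  moreover have "a - x = y" by (simp add: a(1))
  ultimately show "hpart (d * k) a \<in> mp.V.span (mp.products F k)" "a - hpart (d * k) a \<in> MI k"
    using a(2,3) by (simp_all only:)
qed

text \<open>
  Elements of $I^k$ have order at least $dk$; the part of degree $dk$ is a polynomial in the
  generators, and it vanishes exactly on $M I^k$.
\<close>

definition initial :: "('v, 'f) mpoly poly \<Rightarrow> ('v, 'f) mpoly poly" where
  "initial p = (\<Sum>k\<le>Polynomial.degree p. Polynomial.monom (hpart (d * k) (Polynomial.coeff p k)) k)"

lemma coeff_initial: "Polynomial.coeff (initial p) k = hpart (d * k) (Polynomial.coeff p k)"
proof -
  have "Polynomial.coeff (initial p) k =
      (if k \<le> Polynomial.degree p then hpart (d * k) (Polynomial.coeff p k) else 0)"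
    by (simp add: initial_def coeff_sum coeff_monom)
  then show ?thesis by (simp add: coeff_eq_0)
qed

text \<open>Setting \<open>t\<close> to 1 maps into the polynomial ring itself. For
  \<open>d > 0\<close> no information is lost, because the degree \<open>d * k\<close> of a
  component still shows its \<open>k\<close>.\<close>

definition initial_form :: "('v, 'f) mpoly poly \<Rightarrow> ('v, 'f) mpoly" where
  "initial_form p = poly (initial p) 1"

abbreviation rees :: "('v, 'f) mpoly poly set" where
  "rees \<equiv> {p. \<forall>k. Polynomial.coeff p k \<in> ideal_power I k}"

lemma subring_set_rees: "subring_set rees"
proof -
  have "(\<Sum>i\<le>k. Polynomial.coeff p i * Polynomial.coeff q (k - i)) \<in> ideal_power I k"
    if "p \<in> rees" "q \<in> rees" for p q k
  proof -
    have "Polynomial.coeff p i * Polynomial.coeff q (k - i) \<in> ideal_power I k" if "i \<le> k" for i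
      using ideal_power_mult[OF ideal_I, of "Polynomial.coeff p i" i "Polynomial.coeff q (k - i)" "k - i"]
        \<open>p \<in> rees\<close> \<open>q \<in> rees\<close> that by simp
    then have "(\<Sum>i\<in>A. Polynomial.coeff p i * Polynomial.coeff q (k - i)) \<in> ideal_power I k"
      if "A \<subseteq> {..k}" for A using that
      by (induction A rule: infinite_finite_induct) (auto intro: pow_simps)
    then show ?thesis by blast
  qed
  moreover have "- a \<in> ideal_power I k" if "a \<in> ideal_power I k" for a k
    using pow_simps(3)[OF that, of "- 1"] by simp
  ultimately show ?thesis
    by (auto simp: subring_set_def coeff_mult coeff_1 ideal_power_0 intro: pow_simps)
qed

lemma initial_add: "initial (p + q) = initial p + initial q"
  by (rule poly_eqI) (simp add: coeff_initial hpart_add)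

lemma initial_mult:
  assumes "p \<in> rees" "q \<in> rees"
  shows "initial (p * q) = initial p * initial q"
proof (rule poly_eqI)
  fix k
  have "hpart (d * k) (Polynomial.coeff p i * Polynomial.coeff q (k - i)) =
    hpart (d * i) (Polynomial.coeff p i) * hpart (d * (k - i)) (Polynomial.coeff q (k - i))" if "i \<le> k" for i
  proof -
    have "d * k = d * i + d * (k - i)" using that by (simp flip: distrib_left)
    then show ?thesis
      using hpart_mult[of "Polynomial.coeff p i" "d * i" "Polynomial.coeff q (k - i)" "d * (k - i)"]
        assms pow_degs by auto
  qed
  then show "Polynomial.coeff (initial (p * q)) k = Polynomial.coeff (initial p * initial q) k"
    by (simp add: coeff_initial coeff_mult hpart_sum)
qed

lemma initial_const: "initial [:mconst c:] = [:mconst c:]"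
proof (rule poly_eqI)
  fix k
  have "hpart 0 (mconst c :: ('v, 'f) mpoly) = mconst c" by (rule hpart_id) (auto intro: degs_in_mconst)
  then show "Polynomial.coeff (initial [:mconst c:]) k = Polynomial.coeff [:mconst c:] k"
    by (cases k) (simp_all add: coeff_initial)
qed

lemma initial_form_hom: "initial_form \<in> ring_hom (ring_on rees) (ring_on (mp.alg F))"
proof (rule ring_hom_memI)
  fix p q assume "p \<in> carrier (ring_on rees)" "q \<in> carrier (ring_on rees)"
  then have pq: "p \<in> rees" "q \<in> rees" by simp_all
  show "initial_form (p \<otimes>\<^bsub>ring_on rees\<^esub> q) = initial_form p \<otimes>\<^bsub>ring_on (mp.alg F)\<^esub> initial_form q"
    using initial_mult[OF pq] by (simp add: ring_of_type_algebra_simps initial_form_def)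
  show "initial_form (p \<oplus>\<^bsub>ring_on rees\<^esub> q) = initial_form p \<oplus>\<^bsub>ring_on (mp.alg F)\<^esub> initial_form q"
    by (simp add: ring_of_type_algebra_simps initial_form_def initial_add)
  have "mp.V.span (mp.products F k) \<subseteq> mp.alg F" for k
    by (rule mp.span_subset_alg) (auto simp: mp.products_def intro: mp.alg_prod_list mp.alg.gen)
  moreover have "Polynomial.coeff p k \<in> ideal_power I k" for k using pq(1) by simp
  ultimately have "Polynomial.coeff (initial p) k \<in> mp.alg F" for k
    unfolding coeff_initial using hpart_pow(1) by blast
  then have "initial_form p \<in> mp.alg F"
    unfolding initial_form_def by (rule mp.poly_in_alg) simp
  then show "initial_form p \<in> carrier (ring_on (mp.alg F))" by simp
next
  show "initial_form \<one>\<^bsub>ring_on rees\<^esub> = \<one>\<^bsub>ring_on (mp.alg F)\<^esub>"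
    using initial_const[of 1] by (simp add: ring_of_type_algebra_simps initial_form_def one_pCons)
qed

lemma initial_form_surj: "initial_form ` rees = mp.alg F"
proof (intro equalityI subsetI)
  fix x assume "x \<in> initial_form ` rees"
  then show "x \<in> mp.alg F" using ring_hom_closed[OF initial_form_hom] by auto
next
  have R: "p + q \<in> rees" "p * q \<in> rees" if "p \<in> rees" "q \<in> rees" for p q
    using subring_set_rees that unfolding subring_set_def by blast+
  fix x assume "x \<in> mp.alg F"
  then show "x \<in> initial_form ` rees"
  proof induction
    case (const c)
    have "[:mconst c:] \<in> rees" by (auto simp: coeff_pCons ideal_power_0 pow_simps split: nat.split)
    then show ?case using initial_const[of c] by (intro image_eqI[of _ _ "[:mconst c:]"]) (simp_all add: initial_form_def)
  next
    case (gen f)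
    have "f \<in> ideal_power I 1" using products_subset_pow[of 1] gen by (auto simp: mp.products_Suc)
    \<comment> \<open>A generator \<open>f\<close> is the initial form of \<open>f\<close> times
      \<open>t\<close>.\<close>
    then have "Polynomial.monom f 1 \<in> rees" by (auto simp: coeff_monom pow_simps)
    moreover have "initial (Polynomial.monom f 1) = Polynomial.monom f 1"
      using gen F_degs by (intro poly_eqI) (auto simp: coeff_initial coeff_monom hpart_id)
    ultimately show ?case
      by (intro image_eqI[of _ _ "Polynomial.monom f 1"]) (simp_all add: initial_form_def poly_monom)
  next
    case (add a b)
    then obtain p q where "a = initial_form p" "b = initial_form q" "p \<in> rees" "q \<in> rees" by blast
    then show ?case using R(1)
      by (intro image_eqI[of _ _ "p + q"]) (simp_all add: initial_form_def initial_add)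
  next
    case (mult a b)
    then obtain p q where "a = initial_form p" "b = initial_form q" "p \<in> rees" "q \<in> rees" by blast
    then show ?case using R(2) initial_mult
      by (intro image_eqI[of _ _ "p * q"]) (simp_all add: initial_form_def)
  qed
qed

text \<open>The components for different \<open>k\<close> have different degrees
  \<open>d * k\<close> and cannot cancel, so a zero sum means that each vanishes; what is left of a
  coefficient lies in \<open>MI k\<close> by \<open>hpart_pow\<close>.\<close>

lemma initial_form_eq_0_iff:
  assumes "d > 0" "p \<in> rees"
  shows "initial_form p = 0 \<longleftrightarrow> (\<forall>k. Polynomial.coeff p k \<in> MI k)"
proof
  assume 0: "initial_form p = 0"
  show "\<forall>k. Polynomial.coeff p k \<in> MI k"
  proof
    fix j
    have "hpart (d * j) (hpart (d * k) (Polynomial.coeff p k)) =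
      (if k = j then hpart (d * j) (Polynomial.coeff p j) else 0)" for k
    proof (cases "k = j")
      case False
      then have "d * j \<notin> {d * k}" using assms(1) by simp
      from hpart_eq_0[OF hpart_degs this] False show ?thesis by simp
    qed (simp add: hpart_id[OF hpart_degs])
    moreover have "0 = hpart (d * j) (initial_form p)" using 0 by simp
    then have "0 = (\<Sum>k\<le>Polynomial.degree (initial p). hpart (d * j) (hpart (d * k) (Polynomial.coeff p k)))"
      by (simp add: initial_form_def poly_altdef hpart_sum coeff_initial)
    ultimately have "(\<Sum>k\<le>Polynomial.degree (initial p).
      if k = j then hpart (d * j) (Polynomial.coeff p j) else 0) = 0" by simp
    moreover have "hpart (d * j) (Polynomial.coeff p j) = 0" if "\<not> j \<le> Polynomial.degree (initial p)"
      using that coeff_eq_0[of "initial p" j] by (simp add: coeff_initial)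
    ultimately have "hpart (d * j) (Polynomial.coeff p j) = 0" by (auto split: if_splits)
    then show "Polynomial.coeff p j \<in> MI j" using hpart_pow(2)[of "Polynomial.coeff p j" j] assms(2) by simp
  qed
next
  assume "\<forall>k. Polynomial.coeff p k \<in> MI k"
  then have "hpart (d * k) (Polynomial.coeff p k) = 0" for k
    using MI_degs by (intro hpart_eq_0[of _ "{Suc (d * k)..}"]) auto
  then have "initial p = 0" by (intro poly_eqI) (simp add: coeff_initial)
  then show "initial_form p = 0" by (simp add: initial_form_def)
qed

text \<open>First isomorphism theorem for \<open>initial_form\<close>: its kernel is the ideal by
  which the Rees algebra is divided, so the quotient is the algebra generated by
  \<open>F\<close>.\<close>

lemma krull_dim_special_fiber:
  assumes "d > 0"
  shows "krull_dim (special_fiber_ring M I) = krull_dim (ring_on (mp.alg F))"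
proof -
  have cR: "cring (ring_on rees)" by (rule cring_ring_on[OF subring_set_rees])
  have cS: "cring (ring_on (mp.alg F))" by (rule cring_ring_on[OF mp.subring_set_alg])
  interpret h: ring_hom_ring "ring_on rees" "ring_on (mp.alg F)" initial_form
    using cR cS initial_form_hom by (intro ring_hom_ringI2) (auto simp: cring_def)
  have "a_kernel (ring_on rees) (ring_on (mp.alg F)) initial_form = {p. \<forall>k. Polynomial.coeff p k \<in> MI k}"
  proof -
    have "a_kernel (ring_on rees) (ring_on (mp.alg F)) initial_form = {p \<in> rees. initial_form p = 0}"
    proof -
      have "\<zero>\<^bsub>ring_on (mp.alg F)\<^esub> = 0" "carrier (ring_on rees) = rees"
        by (simp_all add: ring_of_type_algebra_simps)
      then show ?thesis by (simp only: a_kernel_def')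
    qed
    also have "\<dots> = {p \<in> rees. \<forall>k. Polynomial.coeff p k \<in> MI k}"
      by (intro Collect_cong conj_cong initial_form_eq_0_iff[OF assms] refl)
    also have "\<dots> = {p. \<forall>k. Polynomial.coeff p k \<in> MI k}" using MI_subset by blast
    finally show ?thesis .
  qed
  then have eq: "special_fiber_ring M I = ring_on rees Quot a_kernel (ring_on rees) (ring_on (mp.alg F)) initial_form"
    by (simp add: special_fiber_ring_def rees_algebra_def)
  have "special_fiber_ring M I \<simeq> ring_on (mp.alg F)"
    unfolding eq by (rule h.FactRing_iso) (simp add: initial_form_surj)
  moreover have "cring (special_fiber_ring M I)"
    unfolding eq by (rule ideal.quotient_is_cring[OF h.kernel_is_ideal cR])
  ultimately show ?thesis by (intro krull_dim_ring_iso cS)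
qed

end

section \<open>The main result\<close>

theorem proposition1p4:
  fixes G :: "'n::{finite,linorder} set set"
    and H :: "'m::{finite,linorder} set set"
  assumes "simple_graph G" and "no_isolated_vertices G"
    and "simple_graph H" and "no_isolated_vertices H"
    and "CHAR('f::field) = 0 \<or> CHAR('f) > 2 ^ (CARD('n) * CARD('m))"
  shows "enat (jacobian_rank TYPE('f) G H)
           = analytic_spread (binomial_edge_ideal G H :: ('n \<times> 'm, 'f) mpoly set)"
proof -
  define F :: "('n \<times> 'm, 'f) mpoly set" where "F = {binomial_gen e e' | e e'. e \<in> G \<and> e' \<in> H}"
  have "F = (\<lambda>(e, e'). binomial_gen e e') ` (G \<times> H)" by (auto simp: F_def)
  then have finF: "finite F" by simp
  have degF: "F \<subseteq> degs_in {2}" using binomial_gen_degs by (auto simp: F_def)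
  interpret homogeneous_generators F 2 by unfold_locales (rule degF)
  \<comment> \<open>One list serves both sides: its length is the rank of the gradients and the
    Krull dimension.\<close>
  obtain ts where ts: "set ts \<subseteq> F" "mp.indep {} ts"
    "\<And>f. f \<in> F \<Longrightarrow> mp.algebraic_over (mp.alg (set ts)) f"
    using mp.indep_extend[OF finF, of "{}" "[]"] by auto
  \<comment> \<open>A positive \<open>k\<close> within the bound is smaller than a positive
    characteristic, hence not divisible by it.\<close>
  have "of_nat k \<noteq> (0 :: 'f)" if "0 < k" "k \<le> 2 ^ CARD('n \<times> 'm)" for k
    using assms(5) that by (auto simp: of_nat_eq_0_iff_char_dvd dest: dvd_imp_le)
  then have "vec.dim (grad ` F) = length ts"
    using degF degs_in_mono[of "{2}" "{..2}"] by (intro dim_grad_image ts) auto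
  moreover have "grad ` F = {jacobian_row e e' | e e'. e \<in> G \<and> e' \<in> H}"
    by (auto simp: F_def jacobian_row_eq_grad)
  ultimately have "jacobian_rank TYPE('f) G H = length ts" by (simp add: jacobian_rank_def)
  moreover have "binomial_edge_ideal G H = I" unfolding binomial_edge_ideal_def I_def by (simp only: F_def)
  then have "analytic_spread (binomial_edge_ideal G H :: ('n \<times> 'm, 'f) mpoly set) = enat (length ts)"
    unfolding analytic_spread_def using krull_dim_special_fiber krull_dim_alg[OF finF ts] by simp
  ultimately show ?thesis by simp
qed

end
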